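(* Let $G$ be a bridgeless mixed graph with $n$ vertices and maximum undirected degree $\Delta^*=\max\{d_G^*(v):v\in V(G)\}$. Then (1) $\overrightarrow{\mathrm{diam}}(G)\le n-\Delta^*+3$ if at least one of the following holds: $G$ is undirected (i.e. has no directed edges); or $G$ has a vertex $u$ with $d_G^*(u)=\Delta^*$ and $d_G^+(u)+d_G^-(u)\ge 2$; or $G$ has a vertex $u$ with $d_G^*(u)=\Delta^*=5$ and $d_G^+(u)+d_G^-(u)=1$; (2) $\overrightarrow{\mathrm{diam}}(G)\le n-\Delta^*+4$ otherwise.
   Context: A mixed graph $G$ is a finite graph whose edge set may contain both undirected edges $xy$ and directed edges $\overrightarrow{xy}$; its underlying graph (forgetting directions) is assumed simple, so between two vertices there is at most one edge, directed or undirected. For a vertex $x$: $d_G^+(x)$ is the number of directed edges leaving $x$, $d_G^-(x)$ the number of directed edges entering $x$, and $d_G^*(x)$ the number of undirected edges incident with $x$. An orientable path from $x_1$ to $x_k$ is a sequence of distinct vertices $x_1,\dots,x_k$ such that for each $1\le i\le k-1$ either $x_ix_{i+1}$ is an undirected edge or $\overrightarrow{x_ix_{i+1}}$ is a directed edge of $G$. $G$ is connected if for any two vertices $x,y$ there are an orientable path from $x$ to $y$ and one from $y$ to $x$. A bridge is an undirected edge whose deletion disconnects the underlying undirected graph. $G$ is bridgeless if it is connected and has no bridge. An orientation of $G$ assigns a direction to every undirected edge (directed edges keep their direction); it is strong if the resulting directed graph is strongly connected. The distance from $x$ to $y$ in a directed graph is the number of edges of a shortest directed path from $x$ to $y$,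 and the diameter is the maximum of these distances over all ordered pairs of vertices. The oriented diameter is $\overrightarrow{\mathrm{diam}}(G)=\min\{\mathrm{diam}(\overrightarrow{G}):\overrightarrow{G}\text{ is a strong orientation of }G\}$. *)

theory Defs
  imports "Graph_Theory.Graph_Theory" "HOL-Library.Extended_Nat"
begin

record 'a mixed_graph =
  mverts :: "'a set"
  uedges :: "'a set set"
  darcs :: "('a \<times> 'a) set"

locale mixed_graph =
  fixes G :: "'a mixed_graph"
  assumes finite_mverts: "finite (mverts G)"
    and mverts_nonempty: "mverts G \<noteq> {}"
    and uedges_wf: "e \<in> uedges G \<Longrightarrow> e \<subseteq> mverts G \<and> card e = 2"
    and darcs_wf: "(x, y) \<in> darcs G \<Longrightarrow> x \<in> mverts G \<and> y \<in> mverts G \<and> x \<noteq> y"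
    and darcs_antiparallel: "(x, y) \<in> darcs G \<Longrightarrow> (y, x) \<notin> darcs G"
    and darcs_uedges: "(x, y) \<in> darcs G \<Longrightarrow> {x, y} \<notin> uedges G"

definition directed_out_degree :: "'a mixed_graph \<Rightarrow> 'a \<Rightarrow> nat" where
  "directed_out_degree G x = card {a \<in> darcs G. fst a = x}"

definition directed_in_degree :: "'a mixed_graph \<Rightarrow> 'a \<Rightarrow> nat" where
  "directed_in_degree G x = card {a \<in> darcs G. snd a = x}"

definition undirected_degree :: "'a mixed_graph \<Rightarrow> 'a \<Rightarrow> nat" where
  "undirected_degree G x = card {e \<in> uedges G. x \<in> e}"

definition max_undirected_degree :: "'a mixed_graph \<Rightarrow> nat" where
  "max_undirected_degree G = Max (undirected_degree G ` mverts G)"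

definition orientable_path :: "'a mixed_graph \<Rightarrow> 'a \<Rightarrow> 'a list \<Rightarrow> 'a \<Rightarrow> bool" where
  "orientable_path G x p y \<longleftrightarrow>
     p \<noteq> [] \<and> hd p = x \<and> last p = y \<and> set p \<subseteq> mverts G \<and> distinct p \<and>
     (\<forall>i. Suc i < length p \<longrightarrow>
        {p ! i, p ! Suc i} \<in> uedges G \<or> (p ! i, p ! Suc i) \<in> darcs G)"

definition mixed_connected :: "'a mixed_graph \<Rightarrow> bool" where
  "mixed_connected G \<longleftrightarrow>
     (\<forall>x \<in> mverts G. \<forall>y \<in> mverts G.
        (\<exists>p. orientable_path G x p y) \<and> (\<exists>p. orientable_path G y p x))"

text \<open>As usual in \<^theory>\<open>Graph_Theory.Digraph\<close>, an undirected graph is a symmetric digraph.\<close>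
definition underlying_graph :: "'a mixed_graph \<Rightarrow> 'a pair_pre_digraph" where
  "underlying_graph G =
     \<lparr> pverts = mverts G,
       parcs = {(x, y). {x, y} \<in> uedges G \<or> (x, y) \<in> darcs G \<or> (y, x) \<in> darcs G} \<rparr>"

definition bridge :: "'a mixed_graph \<Rightarrow> 'a set \<Rightarrow> bool" where
  "bridge G e \<longleftrightarrow>
     e \<in> uedges G \<and>
     \<not> connected (with_proj (underlying_graph (G \<lparr> uedges := uedges G - {e} \<rparr>)))"

definition bridgeless :: "'a mixed_graph \<Rightarrow> bool" where
  "bridgeless G \<longleftrightarrow> mixed_connected G \<and> \<not> (\<exists>e. bridge G e)"

text \<open>\<open>dir\<close> sends each undirected edge to one of the two arcs on its end points.\<close>
definition orientation :: "'a mixed_graph \<Rightarrow> 'a pair_pre_digraph \<Rightarrow> bool" where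
  "orientation G D \<longleftrightarrow>
     (\<exists>dir :: 'a set \<Rightarrow> 'a \<times> 'a.
        (\<forall>e \<in> uedges G. {fst (dir e), snd (dir e)} = e) \<and>
        D = \<lparr> pverts = mverts G, parcs = darcs G \<union> dir ` uedges G \<rparr>)"

definition strong_orientation :: "'a mixed_graph \<Rightarrow> 'a pair_pre_digraph \<Rightarrow> bool" where
  "strong_orientation G D \<longleftrightarrow> orientation G D \<and> strongly_connected (with_proj D)"

definition distance :: "'a pair_pre_digraph \<Rightarrow> 'a \<Rightarrow> 'a \<Rightarrow> enat" where
  "distance D x y = (INF p \<in> {p. pre_digraph.apath (with_proj D) x p y}. enat (length p))"

definition diameter :: "'a pair_pre_digraph \<Rightarrow> enat" where
  "diameter D = (SUP (x, y) \<in> pverts D \<times> pverts D. distance D x y)"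

text \<open>
  The infimum in \<^typ>\<open>enat\<close> of a nonempty set is its minimum; that of the empty set is
  \<open>\<infinity>\<close>, so a finite upper bound on \<open>oriented_diameter\<close> entails that a strong orientation exists.
\<close>
definition oriented_diameter :: "'a mixed_graph \<Rightarrow> enat" where
  "oriented_diameter G = (INF D \<in> {D. strong_orientation G D}. diameter D)"

text \<open>Hence \<^term>\<open>card (mverts G) - max_undirected_degree G\<close> is not truncated.\<close>
lemma (in mixed_graph) max_undirected_degree_less:
  "max_undirected_degree G < card (mverts G)"
proof -
  have "undirected_degree G x < card (mverts G)" if x: "x \<in> mverts G" for x
  proof -
    have "{e \<in> uedges G. x \<in> e} \<subseteq> (\<lambda>y. {x, y}) ` (mverts G - {x})"
    proof
      fix e assume e: "e \<in> {e \<in> uedges G. x \<in> e}"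
      then have "card e = 2" "e \<subseteq> mverts G" "x \<in> e"
        using uedges_wf by auto
      then obtain y where "e = {x, y}" "y \<noteq> x"
        by (auto simp: card_2_iff)
      then show "e \<in> (\<lambda>y. {x, y}) ` (mverts G - {x})"
        using \<open>e \<subseteq> mverts G\<close> by auto
    qed
    then have "undirected_degree G x \<le> card (mverts G - {x})"
      unfolding undirected_degree_def
      by (rule surj_card_le[rotated]) (simp add: finite_mverts)
    then show ?thesis
      using card_Diff1_less[OF finite_mverts x] by linarith
  qed
  then show ?thesis
    unfolding max_undirected_degree_def
    using finite_mverts mverts_nonempty by simp
qed

end

theory Submission
  imports Defs
begin

text \<open>
  Let \<open>u\<close> have maximum undirected degree and let \<open>T\<close> consist of \<open>u\<close>, its undirected neighbours and
  at most two of its directed neighbours. In a strong digraph in which any two vertices of \<open>T\<close> are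
  joined by a walk that passes through \<open>T\<close> at most \<open>k\<close> times after its start, all distances
  are at most \<open>n - card T + k\<close>, as one sees from the distance levels of the starting vertex. So it
  suffices to orient \<open>G\<close> such that every vertex of \<open>T\<close> reaches \<open>u\<close>, and is reached from \<open>u\<close>, through
  few vertices of \<open>T\<close>.

  Split the undirected neighbours of \<open>u\<close> into \<open>A\<close>, whose edges leave \<open>u\<close>, and \<open>B\<close>, whose edges enter
  \<open>u\<close>, with \<open>B\<close> minimal such that every vertex of \<open>A\<close> still has a short way back to \<open>u\<close>. By minimality
  the vertices of \<open>B\<close> are reached quickly from \<open>u\<close> as well. The required walks outside \<open>T\<close> might use an
  undirected edge in both directions, but in a minimal system of such walks an exchange argument
  excludes this. The oriented walks form a strong subgraph, and as there is no bridge the remaining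
  edges can be oriented one by one.
\<close>

section \<open>Walks between vertices of a set\<close>

text \<open>With \<open>d\<close> directed neighbours in \<open>T\<close>, \<open>card T\<close> is
  the undirected degree plus \<open>d + 1\<close>, so a routing constant \<open>k\<close> gives the
  additive term \<open>k - d - 1\<close>. The term 4 is \<open>k = 5\<close>, \<open>d = 0\<close>.
  The term 3 is \<open>k = 4\<close>, \<open>d = 0\<close> for undirected graphs, and
  \<open>k = 6\<close>, \<open>d = 2\<close> or \<open>k = 5\<close>, \<open>d = 1\<close>
  otherwise. Each \<open>k\<close> bounds links to \<open>u\<close> plus links from
  \<open>u\<close>; where the worst sum is one too large, the extremal pairs turn out to be joined
  by a shorter walk that does not pass through \<open>u\<close>.

  The obstacle is that short ways cannot be fixed link by link: uncrossing exchanges walks and may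
  replace one link by another. Hence a vertex only demands some link out of an admissible set, and
  the bounds must hold for every choice. The admissible sets have to survive exchanges, which is why
  they are nested and often larger than the links known to exist. Undirected edges at
  \<open>u\<close> are kept out of the links, so that the links do not depend on the split into
  \<open>A\<close> and \<open>B\<close>.\<close>

definition joined :: "'a rel \<Rightarrow> nat \<Rightarrow> 'a \<Rightarrow> 'a \<Rightarrow> bool" where
  "joined E k p q \<longleftrightarrow> (\<exists>j\<le>k. (p, q) \<in> E ^^ j)"

lemma joined_refl [simp]: "joined E k p p"
  unfolding joined_def by (rule exI[of _ 0]) simp

lemma joined_trans: "joined E i p q \<Longrightarrow> joined E j q r \<Longrightarrow> joined E (i + j) p r"
  unfolding joined_def by (meson add_mono relpow_trans)

lemma joined_mono: "joined E i p q \<Longrightarrow> i \<le> j \<Longrightarrow> joined E j p q"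
  unfolding joined_def by (meson le_trans)

lemma joined_trans_le:
  "joined E i p q \<Longrightarrow> joined E j q r \<Longrightarrow> i + j \<le> k \<Longrightarrow> joined E k p r"
  using joined_trans joined_mono by metis

lemma joined_1: "(p, q) \<in> E \<Longrightarrow> joined E 1 p q"
  unfolding joined_def by (rule exI[of _ 1]) simp

lemma joined_step: "(p, q) \<in> E \<Longrightarrow> joined E j q r \<Longrightarrow> Suc j \<le> k \<Longrightarrow> joined E k p r"
  using joined_trans_le[OF joined_1] by (metis plus_1_eq_Suc)

lemma joined_step_right: "joined E j p q \<Longrightarrow> (q, r) \<in> E \<Longrightarrow> Suc j \<le> k \<Longrightarrow> joined E k p r"
  using joined_trans_le[OF _ joined_1] by (metis Suc_eq_plus1)

lemma joined_imp_rtrancl: "joined E k p q \<Longrightarrow> (p, q) \<in> E\<^sup>*"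
  unfolding joined_def using relpow_imp_rtrancl by metis

lemma relpow_mono: "E \<subseteq> E' \<Longrightarrow> E ^^ n \<subseteq> (E' :: 'a rel) ^^ n"
  by (induction n) (auto intro: relcomp_mono)

lemma joined_mono_rel: "E \<subseteq> E' \<Longrightarrow> joined E k p q \<Longrightarrow> joined E' k p q"
  unfolding joined_def using relpow_mono by blast

lemma relpow_converse: "(E\<inverse>) ^^ n = ((E :: 'a rel) ^^ n)\<inverse>"
  by (induction n) (simp, metis relpow.simps(2) converse_relcomp relpow_commute)

lemma joined_converse [simp]: "joined (E\<inverse>) k p q \<longleftrightarrow> joined E k q p"
  unfolding joined_def by (simp add: relpow_converse)

text \<open>The part of the walk before the first use of \<open>(x, y)\<close> and the part after
  the last use both avoid that arc.\<close>

lemma rtrancl_cut_arc: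
  assumes "(s, t) \<in> R\<^sup>*" "(s, t) \<notin> (R - {(x, y)})\<^sup>*"
  shows "(s, x) \<in> (R - {(x, y)})\<^sup>*" "(y, t) \<in> (R - {(x, y)})\<^sup>*"
proof -
  let ?S = "(R - {(x, y)})\<^sup>*"
  from assms(1) have "(s, t) \<in> ?S \<or> (s, x) \<in> ?S \<and> (y, t) \<in> ?S"
  proof induction
    case (step t w)
    show ?case
    proof (cases "(t, w) = (x, y)")
      case False
      with step show ?thesis by (meson DiffI rtrancl.rtrancl_into_rtrancl singletonD)
    qed (use step in auto)
  qed simp
  with assms(2) show "(s, x) \<in> ?S" "(y, t) \<in> ?S" by simp_all
qed

text \<open>
  Each vertex of \<open>T\<close> is split into a source (tag \<open>False\<close>) and a sink (tag \<open>True\<close>), so that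
  reachability in the lifted relation is reachability without inner vertices in \<open>T\<close>.
\<close>
definition lift :: "'a set \<Rightarrow> 'a rel \<Rightarrow> ('a \<times> bool) rel" where
  "lift T R = {((x, False), (y, y \<in> T)) | x y. (x, y) \<in> R}"

definition link :: "'a set \<Rightarrow> 'a rel \<Rightarrow> 'a \<Rightarrow> 'a \<Rightarrow> bool" where
  "link T R s t \<longleftrightarrow> ((s, False), (t, True)) \<in> (lift T R)\<^sup>*"

lemma in_lift_iff: "((x, b), (y, c)) \<in> lift T R \<longleftrightarrow> (x, y) \<in> R \<and> \<not> b \<and> c = (y \<in> T)"
  unfolding lift_def by auto

lemma lift_mono: "R \<subseteq> R' \<Longrightarrow> lift T R \<subseteq> lift T R'"
  unfolding lift_def by blast

lemma link_mono: "R \<subseteq> R' \<Longrightarrow> link T R s t \<Longrightarrow> link T R' s t"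
  unfolding link_def by (meson lift_mono rtrancl_mono subsetD)

lemma link_arc: "(s, t) \<in> R \<Longrightarrow> t \<in> T \<Longrightarrow> link T R s t"
  unfolding link_def by (rule r_into_rtrancl) (simp add: in_lift_iff)

lemma lift_rtrancl_imp_rtrancl: "(p, q) \<in> (lift T R)\<^sup>* \<Longrightarrow> (fst p, fst q) \<in> R\<^sup>*"
proof (induction rule: rtrancl_induct)
  case (step q r)
  then have "(fst q, fst r) \<in> R" by (cases q; cases r) (simp add: in_lift_iff)
  with step.IH show ?case by (rule rtrancl_into_rtrancl)
qed simp

lemma link_imp_rtrancl: "link T R s t \<Longrightarrow> (s, t) \<in> R\<^sup>*"
  unfolding link_def by (drule lift_rtrancl_imp_rtrancl) simp

lemma link_sink: "link T R s t \<Longrightarrow> t \<in> T"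
  unfolding link_def by (erule rtranclE) (auto simp: in_lift_iff)

lemma lift_source: "(p, (x, False)) \<in> (lift T R)\<^sup>* \<Longrightarrow> x \<in> T \<Longrightarrow> p = (x, False)"
  by (erule rtranclE) (auto simp: in_lift_iff)

lemma lift_sink: "((x, True), q) \<in> (lift T R)\<^sup>* \<Longrightarrow> q = (x, True)"
  by (erule converse_rtranclE) (auto simp: in_lift_iff)

text \<open>A junction \<open>x\<close> in \<open>T\<close> does no harm: \<open>(x, False)\<close>
  is then reached only by a walk that starts there, and \<open>(x, True)\<close> cannot be left, so
  \<open>s = x = t\<close> would follow.\<close>

lemma link_join:
  assumes "((s, False), (x, False)) \<in> (lift T R)\<^sup>*" "((x, x \<in> T), (t, True)) \<in> (lift T R)\<^sup>*"
    and "s \<noteq> t"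
  shows "link T R s t"
proof (cases "x \<in> T")
  case True
  then show ?thesis
    using lift_source[OF assms(1)] lift_sink[of x "(t, True)" T R] assms by auto
next
  case False
  then show ?thesis using assms unfolding link_def by (auto intro: rtrancl_trans)
qed

section \<open>Removing arcs from links, and uncrossing\<close>

lemma lift_Diff: "lift T (R - {(x, y)}) = lift T R - {((x, False), (y, y \<in> T))}"
  unfolding lift_def by auto

text \<open>Both directions of the edge can be deleted at once. If the way from \<open>s\<close> to
  \<open>x\<close> needed \<open>(y, x)\<close>, it would visit \<open>y\<close> earlier and could
  continue from there to \<open>t\<close>, a link without \<open>(x, y)\<close>. The way from
  \<open>y\<close> to \<open>t\<close> is treated likewise at \<open>x\<close>.\<close>

lemma link_cut_edge:
  assumes "link T R s t" "\<not> link T (R - {(x, y)}) s t" "s \<noteq> t"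
  shows "((s, False), (x, False)) \<in> (lift T (R - {(x, y), (y, x)}))\<^sup>*"
    and "((y, y \<in> T), (t, True)) \<in> (lift T (R - {(x, y), (y, x)}))\<^sup>*"
proof -
  let ?L = "lift T (R - {(x, y)})"
  have pre: "((s, False), (x, False)) \<in> ?L\<^sup>*" and suf: "((y, y \<in> T), (t, True)) \<in> ?L\<^sup>*"
    using rtrancl_cut_arc[of "(s, False)" "(t, True)" "lift T R"] assms(1,2)
    unfolding link_def lift_Diff by auto
  have eq: "lift T (R - {(x, y), (y, x)}) = ?L - {((y, False), (x, x \<in> T))}"
    unfolding lift_Diff[symmetric] by (rule arg_cong[where f = "lift T"]) blast
  note cut = rtrancl_cut_arc[where R = ?L and x = "(y, False)" and y = "(x, x \<in> T)"]
  have sub: "(?L - {((y, False), (x, x \<in> T))})\<^sup>* \<subseteq> ?L\<^sup>*"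
    by (rule rtrancl_mono) blast
  show "((s, False), (x, False)) \<in> (lift T (R - {(x, y), (y, x)}))\<^sup>*"
  proof (rule ccontr)
    assume "\<not> ?thesis"
    then have "((s, False), (y, False)) \<in> ?L\<^sup>*"
      using cut(1)[OF pre] sub unfolding eq by blast
    then show False using link_join suf assms(2,3) by metis
  qed
  show "((y, y \<in> T), (t, True)) \<in> (lift T (R - {(x, y), (y, x)}))\<^sup>*"
  proof (rule ccontr)
    assume "\<not> ?thesis"
    then have "((x, x \<in> T), (t, True)) \<in> ?L\<^sup>*"
      using cut(2)[OF suf] sub unfolding eq by blast
    then show False using link_join pre assms(2,3) by metis
  qed
qed

text \<open>Members are demands, each to be met by at least one link. Swapping the ends of two
  demanded links must again serve one of the two demands; the case of equal demands is included.
  Irreflexivity gives the swapped link distinct ends, as \<open>link_join\<close> requires.\<close>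

definition uncrossable :: "'a rel set \<Rightarrow> bool" where
  "uncrossable \<R> \<longleftrightarrow>
     (\<forall>\<rho> \<in> \<R>. irrefl \<rho>) \<and>
     (\<forall>\<rho> \<in> \<R>. \<forall>\<sigma> \<in> \<R>. \<forall>s t s' t'. (s, t) \<in> \<rho> \<longrightarrow> (s', t') \<in> \<sigma> \<longrightarrow>
        (s, t') \<in> \<rho> \<union> \<sigma> \<or> (s', t) \<in> \<rho> \<union> \<sigma>)"

definition links :: "'a set \<Rightarrow> 'a rel \<Rightarrow> 'a rel" where
  "links T R = {(s, t). s \<in> T \<and> s \<noteq> t \<and> link T R s t}"

lemma in_links_iff: "(s, t) \<in> links T R \<longleftrightarrow> s \<in> T \<and> s \<noteq> t \<and> link T R s t"
  unfolding links_def by simp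

lemma links_subset: "links T R \<subseteq> T \<times> T"
  by (clarsimp simp: in_links_iff) (erule link_sink)

lemma links_mono: "R \<subseteq> R' \<Longrightarrow> links T R \<subseteq> links T R'"
  by (clarsimp simp: in_links_iff) (erule link_mono)

text \<open>
  If a minimal arc set contained both \<open>(x, y)\<close> and \<open>(y, x)\<close>, then the two walks
  that need these arcs could be exchanged at \<open>x\<close> or at \<open>y\<close>, making one of the arcs superfluous.
\<close>
lemma uncross:
  assumes fin: "finite Q" and unc: "uncrossable \<R>"
    and meet: "\<And>\<rho>. \<rho> \<in> \<R> \<Longrightarrow> \<rho> \<inter> links T Q \<noteq> {}"
  obtains R where "R \<subseteq> Q" "\<And>\<rho>. \<rho> \<in> \<R> \<Longrightarrow> \<rho> \<inter> links T R \<noteq> {}" "R \<inter> R\<inverse> = {}"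
    and "\<And>x y. (x, y) \<in> R \<Longrightarrow> \<exists>s \<in> T. \<exists>t \<in> T. (s, x) \<in> R\<^sup>* \<and> (y, t) \<in> R\<^sup>*"
proof -
  let ?good = "\<lambda>R. R \<subseteq> Q \<and> (\<forall>\<rho> \<in> \<R>. \<rho> \<inter> links T R \<noteq> {})"
  obtain R where R: "?good R" and min: "\<And>S. ?good S \<Longrightarrow> card R \<le> card S"
    using ex_has_least_nat[of ?good Q card] meet by auto
  have finR: "finite R" using R fin finite_subset by blast
  have needed: "\<exists>\<rho> \<in> \<R>. \<exists>s t. (s, t) \<in> \<rho> \<and> s \<in> T \<and> s \<noteq> t \<and> link T R s t \<and>
      \<rho> \<inter> links T (R - {e}) = {}" if e: "e \<in> R" for e
  proof -
    have "\<not> ?good (R - {e})"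
      using min[of "R - {e}"] card_Diff1_less[OF finR e] by linarith
    then obtain \<rho> where \<rho>: "\<rho> \<in> \<R>" "\<rho> \<inter> links T (R - {e}) = {}" using R by blast
    obtain p where "p \<in> \<rho> \<inter> links T R" using R \<rho>(1) by blast
    then show ?thesis using \<rho> by (cases p) (auto simp: in_links_iff)
  qed
  have anti: "R \<inter> R\<inverse> = {}"
  proof (rule ccontr)
    assume "R \<inter> R\<inverse> \<noteq> {}"
    then obtain x y where xy: "(x, y) \<in> R" "(y, x) \<in> R" by auto
    obtain \<rho> s t where \<rho>: "\<rho> \<in> \<R>" "(s, t) \<in> \<rho>" "s \<in> T" "s \<noteq> t" "link T R s t"
        "\<rho> \<inter> links T (R - {(x, y)}) = {}"
      using needed[OF xy(1)] by blast
    obtain \<sigma> s' t' where \<sigma>: "\<sigma> \<in> \<R>" "(s', t') \<in> \<sigma>" "s' \<in> T" "s' \<noteq> t'" "link T R s' t'"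
        "\<sigma> \<inter> links T (R - {(y, x)}) = {}"
      using needed[OF xy(2)] by blast
    have nl: "\<not> link T (R - {(x, y)}) s t" "\<not> link T (R - {(y, x)}) s' t'"
      using \<rho> \<sigma> by (auto simp: in_links_iff disjoint_iff)
    let ?S = "R - {(x, y), (y, x)}"
    have comm: "R - {(y, x), (x, y)} = ?S" by blast
    note c1 = link_cut_edge[OF \<rho>(5) nl(1) \<rho>(4)]
    note c2 = link_cut_edge[OF \<sigma>(5) nl(2) \<sigma>(4), unfolded comm]
    have sub: "links T ?S \<subseteq> links T (R - {(x, y)})" "links T ?S \<subseteq> links T (R - {(y, x)})"
      by (intro links_mono; blast)+
    have irr: "a \<noteq> b" if "(a, b) \<in> \<rho> \<union> \<sigma>" for a b
      using unc \<rho>(1) \<sigma>(1) that unfolding uncrossable_def irrefl_def by blast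
    have no: "(a, b) \<notin> \<rho> \<union> \<sigma>" if "(a, b) \<in> links T ?S" for a b
      using that sub \<rho>(6) \<sigma>(6) by blast
    \<comment> \<open>The way from \<open>s\<close> to \<open>x\<close> is continued by the way from
      \<open>x\<close> to \<open>t'\<close>. Both avoid the two arcs, so a demand containing
      \<open>(s, t')\<close> would survive the removal of an arc that it needs. The next claim does
      the same at \<open>y\<close>.\<close>
    have "(s, t') \<notin> \<rho> \<union> \<sigma>"
      using no irr link_join[OF c1(1) c2(2)] \<rho>(3) unfolding in_links_iff by metis
    moreover have "(s', t) \<notin> \<rho> \<union> \<sigma>"
      using no irr link_join[OF c2(1) c1(2)] \<sigma>(3) unfolding in_links_iff by metis
    ultimately show False
      using unc \<rho>(1,2) \<sigma>(1,2) unfolding uncrossable_def by blast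
  qed
  \<comment> \<open>Minimality also excludes stray arcs: an arc needed by some demand lies on a walk
    between vertices of \<open>T\<close>. This later makes the chosen arcs strongly
    connected.\<close>
  have ends: "\<exists>s \<in> T. \<exists>t \<in> T. (s, x) \<in> R\<^sup>* \<and> (y, t) \<in> R\<^sup>*" if xy: "(x, y) \<in> R" for x y
  proof -
    obtain \<rho> s t where \<rho>: "(s, t) \<in> \<rho>" "s \<in> T" "s \<noteq> t" "link T R s t"
        "\<rho> \<inter> links T (R - {(x, y)}) = {}"
      using needed[OF xy] by blast
    then have nl: "\<not> link T (R - {(x, y)}) s t" by (auto simp: in_links_iff disjoint_iff)
    note c = link_cut_edge[OF \<rho>(4) nl \<rho>(3), THEN lift_rtrancl_imp_rtrancl, unfolded fst_conv]
    have "(R - {(x, y), (y, x)})\<^sup>* \<subseteq> R\<^sup>*" by (rule rtrancl_mono) blast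
    then have "(s, x) \<in> R\<^sup>*" "(y, t) \<in> R\<^sup>*" using c by (simp_all add: subset_iff)
    then show ?thesis using \<rho>(2) link_sink[OF \<rho>(4)] by metis
  qed
  show ?thesis
  proof (rule that[of R])
    show "R \<subseteq> Q" using R by simp
    show "\<rho> \<inter> links T R \<noteq> {}" if "\<rho> \<in> \<R>" for \<rho> using R that by simp
  qed (fact anti, fact ends)
qed

section \<open>Reversing links and extracting them from walks\<close>

lemma link_converse:
  assumes "link T R s t" "s \<in> T"
  shows "link T (R\<inverse>) t s"
proof -
  \<comment> \<open>The walk is reversed arc by arc. The alternative \<open>v = s\<close> stands for
    the empty walk, whose reversal has no last arc into the sink of \<open>s\<close> yet.\<close>
  have "v = s \<and> \<not> b \<or> ((v, False), (s, True)) \<in> (lift T (R\<inverse>))\<^sup>* \<and> b = (v \<in> T)"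
    if "((s, False), (v, b)) \<in> (lift T R)\<^sup>*" for v b
    using that
  proof (induction "(v, b)" arbitrary: v b rule: rtrancl_induct)
    case (step p w c)
    obtain v where p: "p = (v, False)" and vw: "(v, w) \<in> R" "c = (w \<in> T)"
      using step(2) by (cases p) (auto simp: in_lift_iff)
    from step(3)[OF p] have "v = s \<or> ((v, False), (s, True)) \<in> (lift T (R\<inverse>))\<^sup>* \<and> v \<notin> T"
      by auto
    moreover have "((w, False), (v, v \<in> T)) \<in> lift T (R\<inverse>)"
      using vw by (simp add: in_lift_iff)
    ultimately have "((w, False), (s, True)) \<in> (lift T (R\<inverse>))\<^sup>*"
      using assms(2) by (auto intro: converse_rtrancl_into_rtrancl)
    then show ?case using vw by simp
  qed simp
  from this[of t True] show ?thesis using assms link_sink[OF assms(1)]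
    unfolding link_def by auto
qed

lemma link_converse_iff: "s \<in> T \<Longrightarrow> t \<in> T \<Longrightarrow> link T (R\<inverse>) t s \<longleftrightarrow> link T R s t"
  using link_converse[of T R s t] link_converse[of T "R\<inverse>" t s] by auto

lemma links_converse: "links T (R\<inverse>) = (links T R)\<inverse>"
proof -
  have "(s, t) \<in> links T (R\<inverse>) \<longleftrightarrow> (t, s) \<in> links T R" for s t
    unfolding in_links_iff by (metis link_converse_iff link_sink)
  then show ?thesis by auto
qed

text \<open>Stop the walk when it first meets \<open>T - S\<close> and go back to its last visit to
  \<open>S\<close>: every arc in between starts in \<open>S\<close> or outside \<open>T\<close>.
  Only such arcs have to lie in \<open>Q\<close>, so walks of the whole graph yield links that avoid
  certain edges at vertices of \<open>T\<close>.\<close>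

lemma link_leaving:
  assumes "(s, t) \<in> E\<^sup>*" "s \<in> S" "t \<in> T - S" "S \<subseteq> T"
    and Q: "\<And>v w. (v, w) \<in> E \<Longrightarrow> v \<in> S \<or> v \<notin> T \<Longrightarrow> (v, w) \<in> Q"
  shows "\<exists>s' \<in> S. \<exists>t' \<in> T - S. (s', t') \<in> links T Q"
proof -
  have "v \<in> S \<or> (\<exists>s' \<in> S. \<exists>t' \<in> T - S. link T Q s' t')
      \<or> v \<notin> T \<and> (\<exists>s' \<in> S. ((s', False), (v, False)) \<in> (lift T Q)\<^sup>*)"
    if "(s, v) \<in> E\<^sup>*" for v
    using that
  proof induction
    case (step v w)
    show ?case
    proof (cases "\<exists>s' \<in> S. \<exists>t' \<in> T - S. link T Q s' t'")
      case False
      then obtain s' where s': "s' \<in> S" "((s', False), (v, False)) \<in> (lift T Q)\<^sup>*" "v \<in> S \<or> v \<notin> T"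
        using step.IH by blast
      then have "((v, False), (w, w \<in> T)) \<in> lift T Q"
        using Q step.hyps by (simp add: in_lift_iff)
      then have "((s', False), (w, w \<in> T)) \<in> (lift T Q)\<^sup>*" using s'(2) by simp
      then show ?thesis using s'(1) unfolding link_def by (cases "w \<in> T") auto
    qed simp
  qed (use assms(2) in simp)
  from this[OF assms(1)] show ?thesis
    using assms(3,4) unfolding in_links_iff by (metis DiffE subsetD)
qed

section \<open>Distance levels along links\<close>

lemma link_hits_levels:
  fixes \<delta> :: "'a \<Rightarrow> nat"
  assumes step: "\<And>v w. (v, w) \<in> D \<Longrightarrow> \<delta> w \<le> Suc (\<delta> v)"
    and link: "link T D s t" and i: "\<delta> s < i" "i < \<delta> t" and D: "D \<subseteq> V \<times> V"
  shows "\<exists>v \<in> V - T. \<delta> v = i"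
proof -
  have "\<forall>i. \<delta> s < i \<and> i < \<delta> v \<longrightarrow> (\<exists>w \<in> V - T. \<delta> w = i)"
    if "((s, False), (v, b)) \<in> (lift T D)\<^sup>*" for v b
    using that
  proof (induction "(v, b)" arbitrary: v b rule: rtrancl_induct)
    case (step p w c)
    obtain v where p: "p = (v, False)" and vw: "(v, w) \<in> D"
      using step(2) by (cases p) (auto simp: in_lift_iff)
    have v: "v = s \<or> v \<in> V - T"
      using lift_source[of "(s, False)" v T D] step(1) vw D unfolding p by auto
    have w: "\<delta> w \<le> Suc (\<delta> v)" using assms(1) vw .
    show ?case
    proof (intro allI impI)
      fix i assume i: "\<delta> s < i \<and> i < \<delta> w"
      show "\<exists>w \<in> V - T. \<delta> w = i"
      \<comment> \<open>Levels rise by at most one per arc, so the only new level below that of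
        \<open>w\<close> is the level of \<open>v\<close>; and \<open>v\<close> lies outside
        \<open>T\<close>, since \<open>v = s\<close> contradicts the lower bound on
        \<open>i\<close>.\<close>
      proof (cases "i < \<delta> v")
        case True
        then show ?thesis using step(3)[OF p] i by blast
      next
        case False
        then have "i = \<delta> v" using i w by linarith
        then show ?thesis using v i by auto
      qed
    qed
  qed auto
  then show ?thesis using link i unfolding link_def by blast
qed

text \<open>\<open>K\<close> collects the levels of the at most \<open>j + 1\<close> vertices at
  which the walk stops; all other levels between its ends are crossed inside single steps.\<close>

lemma relpow_hits_levels:
  fixes \<delta> :: "'a \<Rightarrow> nat"
  assumes "(p, q) \<in> E ^^ j"
    and "\<And>v w i. (v, w) \<in> E \<Longrightarrow> \<delta> v < i \<Longrightarrow> i < \<delta> w \<Longrightarrow> i \<in> M"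
  shows "\<exists>K. finite K \<and> card K \<le> Suc j \<and> {\<delta> p..\<delta> q} \<subseteq> K \<union> M"
  using assms(1)
proof (induction j arbitrary: q)
  case 0
  then show ?case by (intro exI[of _ "{\<delta> p}"]) auto
next
  case (Suc j)
  then obtain r where r: "(p, r) \<in> E ^^ j" "(r, q) \<in> E" by auto
  then obtain K where K: "finite K" "card K \<le> Suc j" "{\<delta> p..\<delta> r} \<subseteq> K \<union> M"
    using Suc.IH by blast
  have "i \<in> insert (\<delta> q) K \<union> M" if "i \<in> {\<delta> p..\<delta> q}" for i
    using that K(3) assms(2)[OF r(2), of i] by (cases "i \<le> \<delta> r"; cases "i = \<delta> q") auto
  then have "{\<delta> p..\<delta> q} \<subseteq> insert (\<delta> q) K \<union> M" by blast
  moreover have "card (insert (\<delta> q) K) \<le> Suc (Suc j)"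
    using K(1,2) by (simp add: card_insert_if)
  ultimately show ?case using K(1) by (meson finite_insert)
qed

text \<open>
  Consider the distance levels of \<open>x\<close> that consist of vertices of \<open>T\<close> only. A walk from a vertex of
  the first to a vertex of the last of them meets each of these levels in \<open>T\<close>.
\<close>
lemma joined_if_links_joined:
  assumes fin: "finite V" and TV: "T \<subseteq> V" and DV: "D \<subseteq> V \<times> V"
    and strong: "\<And>x y. x \<in> V \<Longrightarrow> y \<in> V \<Longrightarrow> (x, y) \<in> D\<^sup>*"
    and T: "\<And>p q. p \<in> T \<Longrightarrow> q \<in> T \<Longrightarrow> joined (links T D) k p q"
    and xy: "x \<in> V" "y \<in> V"
  shows "joined D (card V - card T + k) x y"
proof -
  define \<delta> where "\<delta> v = (LEAST n. (x, v) \<in> D ^^ n)" for v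
  have least: "(x, v) \<in> D ^^ \<delta> v" if "v \<in> V" for v
    unfolding \<delta>_def using rtrancl_imp_relpow[OF strong[OF xy(1) that]] by (metis LeastI)
  have le: "\<delta> v \<le> n" if "(x, v) \<in> D ^^ n" for v n
    unfolding \<delta>_def using that by (rule Least_le)
  have step: "\<delta> w \<le> Suc (\<delta> v)" if "(v, w) \<in> D" for v w
    using le[of w "Suc (\<delta> v)"] least[of v] that DV by auto
  have attained: "\<exists>v \<in> V. \<delta> v = i" if "w \<in> V" "i \<le> \<delta> w" for w i
    using that
  proof (induction "\<delta> w" arbitrary: w)
    case 0
    then show ?case by auto
  next
    case (Suc n)
    show ?case
    proof (cases "i = \<delta> w")
      case False
      have "(x, w) \<in> D ^^ Suc n" using least[OF Suc.prems(1)] Suc.hyps(2) by simp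
      then obtain v where v: "(x, v) \<in> D ^^ n" "(v, w) \<in> D" by auto
      then have "\<delta> v = n" using le[OF v(1)] step[OF v(2)] Suc.hyps(2) by linarith
      moreover have "v \<in> V" using v DV by blast
      ultimately show ?thesis using Suc False by force
    qed (use Suc in auto)
  qed
  let ?M = "\<delta> ` (V - T)"
  define J where "J = {..\<delta> y} - ?M"
  have finJ: "finite J" unfolding J_def by simp
  have JT: "\<exists>p \<in> T. \<delta> p = i" if "i \<in> J" for i
    using attained[OF xy(2), of i] that unfolding J_def by auto
  have J: "card J \<le> Suc k"
  proof (cases "J = {}")
    case False
    then have mm: "Min J \<in> J" "Max J \<in> J" using finJ by simp_all
    obtain p q where p: "p \<in> T" "\<delta> p = Min J" and q: "q \<in> T" "\<delta> q = Max J"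
      using JT mm by metis
    obtain j where j: "j \<le> k" "(p, q) \<in> links T D ^^ j"
      using T[OF p(1) q(1)] unfolding joined_def by blast
    obtain K where K: "finite K" "card K \<le> Suc j" "{\<delta> p..\<delta> q} \<subseteq> K \<union> ?M"
    proof -
      have "i \<in> ?M" if "(v, w) \<in> links T D" "\<delta> v < i" "i < \<delta> w" for v w i
        using link_hits_levels[of D \<delta> T v w i V] step that DV by (auto simp: in_links_iff)
      then show thesis using relpow_hits_levels[OF j(2), of \<delta> ?M] that by blast
    qed
    have "J \<subseteq> {\<delta> p..\<delta> q}" using finJ p q by auto
    then have "J \<subseteq> K" using K(3) unfolding J_def by blast
    then show ?thesis using card_mono[OF K(1)] K(2) j(1) by (meson le_trans Suc_le_mono)
  qed simp
  \<comment> \<open>The levels from 0 to that of \<open>y\<close> are counted: at most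
    \<open>Suc k\<close> belong to \<open>J\<close>, and each other one has a vertex of
    \<open>V - T\<close> of its own. Counting level 0 absorbs the extra one in
    \<open>Suc k\<close>.\<close>
  have "Suc (\<delta> y) = card ({..\<delta> y} \<inter> ?M) + card J"
    unfolding J_def using card_Diff_subset_Int[of "{..\<delta> y}" ?M]
    by (metis add.commute card_Int_Diff card_atMost finite_atMost)
  also have "card ({..\<delta> y} \<inter> ?M) \<le> card (V - T)"
    using fin by (meson Int_lower2 card_image_le card_mono finite_Diff finite_imageI le_trans)
  also have "card (V - T) = card V - card T"
    using fin TV by (simp add: card_Diff_subset finite_subset)
  finally have "\<delta> y \<le> card V - card T + k" using J by linarith
  then show ?thesis unfolding joined_def using least[OF xy(2)] by blast
qed

section \<open>Strong orientations of bridgeless mixed graphs\<close>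

definition steps :: "'a rel \<Rightarrow> 'a set set \<Rightarrow> 'a rel" where
  "steps Q U = Q \<union> {(x, y). {x, y} \<in> U}"

lemma in_steps_iff: "(x, y) \<in> steps Q U \<longleftrightarrow> (x, y) \<in> Q \<or> {x, y} \<in> U"
  unfolding steps_def by simp

lemma rtrancl_closed:
  assumes "(x, y) \<in> E\<^sup>*" "x \<in> S" "\<And>a b. (a, b) \<in> E \<Longrightarrow> a \<in> S \<Longrightarrow> b \<in> S"
  shows "y \<in> S"
  using assms by (induction rule: rtrancl_induct) auto

lemma rtrancl_replace:
  assumes "(x, y) \<in> E\<^sup>*" "\<And>a b. (a, b) \<in> E \<Longrightarrow> (a, b) \<in> F\<^sup>*"
  shows "(x, y) \<in> F\<^sup>*"
  using assms by (induction rule: rtrancl_induct) (auto intro: rtrancl_trans)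

text \<open>
  If neither end could reach the other without the edge \<open>{x, y}\<close>, then the vertices reachable
  from \<open>x\<close> and those reachable from \<open>y\<close> would partition \<open>V\<close>, and \<open>{x, y}\<close> would be a bridge.
\<close>
lemma nonbridge_orientable:
  assumes strong: "\<And>a b. a \<in> V \<Longrightarrow> b \<in> V \<Longrightarrow> (a, b) \<in> (E \<union> {(x, y), (y, x)})\<^sup>*"
    and bridge: "(x, y) \<in> (E \<union> E\<inverse>)\<^sup>*" and xy: "x \<in> V" "y \<in> V" and E: "E \<subseteq> V \<times> V"
  shows "(x, y) \<in> E\<^sup>* \<or> (y, x) \<in> E\<^sup>*"
proof (rule ccontr)
  assume "\<not> ?thesis"
  then have nxy: "(x, y) \<notin> E\<^sup>*" and nyx: "(y, x) \<notin> E\<^sup>*" by auto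
  have cover: "(x, z) \<in> E\<^sup>* \<or> (y, z) \<in> E\<^sup>*" if "z \<in> V" for z
    using strong[OF xy(1) that]
    by (induction rule: rtrancl_induct) (auto intro: rtrancl_into_rtrancl)
  have disjoint: "\<not> ((x, z) \<in> E\<^sup>* \<and> (y, z) \<in> E\<^sup>*)" if z: "z \<in> V" for z
  proof
    assume *: "(x, z) \<in> E\<^sup>* \<and> (y, z) \<in> E\<^sup>*"
    have "(z, x) \<in> E\<^sup>* \<or> (z, y) \<in> E\<^sup>*"
    proof -
      have "(z, w) \<in> E\<^sup>* \<or> (z, x) \<in> E\<^sup>* \<or> (z, y) \<in> E\<^sup>*"
        if "(z, w) \<in> (E \<union> {(x, y), (y, x)})\<^sup>*" for w
        using that by (induction rule: rtrancl_induct) (auto intro: rtrancl_into_rtrancl)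
      then show ?thesis using strong[OF z xy(1)] by blast
    qed
    then show False using * nxy nyx by (meson rtrancl_trans)
  qed
  have "y \<in> {z. (x, z) \<in> E\<^sup>*}"
    using bridge
  proof (rule rtrancl_closed)
    fix a b assume ab: "(a, b) \<in> E \<union> E\<inverse>" "a \<in> {z. (x, z) \<in> E\<^sup>*}"
    have V: "a \<in> V" "b \<in> V" using ab(1) E by auto
    show "b \<in> {z. (x, z) \<in> E\<^sup>*}"
    proof (cases "(a, b) \<in> E")
      case True
      then show ?thesis using ab(2) by (auto intro: rtrancl_into_rtrancl)
    next
      case False
      then have "(b, a) \<in> E" using ab(1) by simp
      then have "(y, b) \<notin> E\<^sup>*"
        using disjoint[OF V(1)] ab(2) by (auto intro: rtrancl_into_rtrancl)
      then show ?thesis using cover[OF V(2)] by simp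
    qed
  qed simp
  then show False using nxy by simp
qed

text \<open>Robbins' theorem for mixed graphs, with the arcs in \<open>Q\<close> already fixed. An
  edge \<open>{x, y}\<close> is directed from \<open>x\<close> to \<open>y\<close> if
  \<open>y\<close> reaches \<open>x\<close> without it, so that the lost step can be replaced by a
  walk. Bridges cannot appear, because the underlying graph stays the same.\<close>

lemma strong_orientation_exists:
  assumes "finite U" and "\<And>e. e \<in> U \<Longrightarrow> e \<subseteq> V \<and> card e = 2" and "Q \<subseteq> V \<times> V"
    and "\<And>a b. a \<in> V \<Longrightarrow> b \<in> V \<Longrightarrow> (a, b) \<in> (steps Q U)\<^sup>*"
    and "\<And>x y. {x, y} \<in> U \<Longrightarrow> (x, y) \<in> (steps (Q \<union> Q\<inverse>) (U - {{x, y}}))\<^sup>*"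
  shows "\<exists>dir. (\<forall>e \<in> U. {fst (dir e), snd (dir e)} = e) \<and>
    (\<forall>a \<in> V. \<forall>b \<in> V. (a, b) \<in> (Q \<union> dir ` U)\<^sup>*)"
  using assms
proof (induction U arbitrary: Q rule: finite_induct)
  case empty
  then show ?case by (auto simp: steps_def)
next
  case (insert e U)
  have e: "e \<subseteq> V" "card e = 2" using insert.prems(1) by auto
  have Usub: "steps Q U \<subseteq> V \<times> V"
    using insert.prems(1,2) by (auto simp: steps_def)
  obtain x y where xy: "e = {x, y}" "x \<in> V" "y \<in> V" "(y, x) \<in> (steps Q U)\<^sup>*"
  proof -
    obtain a b where ab: "e = {a, b}" "a \<noteq> b" using e(2) by (auto simp: card_2_iff)
    have V: "a \<in> V" "b \<in> V" using ab e by auto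
    have "(a, b) \<in> (steps Q U)\<^sup>* \<or> (b, a) \<in> (steps Q U)\<^sup>*"
    proof (rule nonbridge_orientable[OF _ _ V Usub])
      have "steps Q (insert e U) \<subseteq> steps Q U \<union> {(a, b), (b, a)}"
        using ab by (auto simp: in_steps_iff doubleton_eq_iff)
      then show "(c, d) \<in> (steps Q U \<union> {(a, b), (b, a)})\<^sup>*" if "c \<in> V" "d \<in> V" for c d
        using insert.prems(3)[OF that] rtrancl_mono by blast
      have "steps (Q \<union> Q\<inverse>) (insert e U - {{a, b}}) \<subseteq> steps Q U \<union> (steps Q U)\<inverse>"
        using ab by (auto simp: in_steps_iff)
      then show "(a, b) \<in> (steps Q U \<union> (steps Q U)\<inverse>)\<^sup>*"
        using insert.prems(4)[of a b] ab rtrancl_mono by blast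
    qed
    then show thesis using that[of a b] that[of b a] ab V by (auto simp: insert_commute)
  qed
  let ?Q = "insert (x, y) Q"
  have "\<exists>dir. (\<forall>e \<in> U. {fst (dir e), snd (dir e)} = e) \<and>
    (\<forall>a \<in> V. \<forall>b \<in> V. (a, b) \<in> (?Q \<union> dir ` U)\<^sup>*)"
  proof (rule insert.IH)
    show "f \<subseteq> V \<and> card f = 2" if "f \<in> U" for f using insert.prems(1) that by simp
    show "?Q \<subseteq> V \<times> V" using insert.prems(2) xy by simp
    show "(a, b) \<in> (steps ?Q U)\<^sup>*" if "a \<in> V" "b \<in> V" for a b
      using insert.prems(3)[OF that]
    proof (rule rtrancl_replace)
      fix c d assume cd: "(c, d) \<in> steps Q (insert e U)"
      show "(c, d) \<in> (steps ?Q U)\<^sup>*"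
      proof (cases "(c, d) = (y, x)")
        case True
        have "steps Q U \<subseteq> steps ?Q U" by (auto simp: in_steps_iff)
        then show ?thesis using xy(4) True rtrancl_mono by blast
      next
        case False
        then have "(c, d) \<in> steps ?Q U"
          using cd xy(1) by (auto simp: in_steps_iff doubleton_eq_iff)
        then show ?thesis by simp
      qed
    qed
    show "(a, b) \<in> (steps (?Q \<union> ?Q\<inverse>) (U - {{a, b}}))\<^sup>*" if ab: "{a, b} \<in> U" for a b
    proof -
      have "(a, b) \<in> (steps (Q \<union> Q\<inverse>) (insert e U - {{a, b}}))\<^sup>*"
        using insert.prems(4) ab by simp
      moreover have "steps (Q \<union> Q\<inverse>) (insert e U - {{a, b}}) \<subseteq> steps (?Q \<union> ?Q\<inverse>) (U - {{a, b}})"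
        using xy(1) by (auto simp: in_steps_iff doubleton_eq_iff)
      ultimately show ?thesis using rtrancl_mono by blast
    qed
  qed
  then obtain dir where dir: "\<forall>e \<in> U. {fst (dir e), snd (dir e)} = e"
    "\<forall>a \<in> V. \<forall>b \<in> V. (a, b) \<in> (?Q \<union> dir ` U)\<^sup>*" by blast
  let ?dir = "dir(e := (x, y))"
  have "?Q \<union> dir ` U = Q \<union> ?dir ` insert e U" using insert.hyps by auto
  then show ?case using dir xy(1) insert.hyps by (intro exI[of _ ?dir]) auto
qed

section \<open>Routing through the neighbourhood of a vertex\<close>

text \<open>
  Each member of \<open>\<R>\<close> is a set of links one of which must be kept. For \<open>a \<in> A \<union> X\<close> this is
  \<open>{a} \<times> \<Theta> a\<close> with \<open>\<Theta> a\<close> the admissible next stops on the way to \<open>u\<close>, and for \<open>b \<in> B \<union> Y\<close>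
  it is \<open>\<Sigma> b \<times> {b}\<close> with \<open>\<Sigma> b\<close> the admissible previous stops on the way from \<open>u\<close>.
\<close>
definition routing :: "'a rel \<Rightarrow> 'a \<Rightarrow> 'a set \<Rightarrow> 'a set \<Rightarrow> 'a set \<Rightarrow> nat \<Rightarrow> bool" where
  "routing F u N X Y k \<longleftrightarrow>
     (\<exists>A B \<R>. A \<union> B = N \<and> A \<inter> B = {} \<and> uncrossable \<R> \<and> (\<forall>\<rho> \<in> \<R>. \<rho> \<inter> F \<noteq> {}) \<and>
        (\<forall>F' \<subseteq> F. (\<forall>\<rho> \<in> \<R>. \<rho> \<inter> F' \<noteq> {}) \<longrightarrow>
           (\<forall>p \<in> insert u (N \<union> X \<union> Y). \<forall>q \<in> insert u (N \<union> X \<union> Y).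
              joined (F' \<union> {u} \<times> (A \<union> X) \<union> (B \<union> Y) \<times> {u}) k p q)))"

text \<open>Exchanging two demands of the same kind is harmless because the admissible sets are
  nested; for a demand at \<open>a\<close> and one at \<open>b\<close>, \<open>cross\<close> makes
  the link \<open>(a, b)\<close> itself admissible. In the last hypothesis the kept links are still
  known to lie in \<open>F\<close>, so that facts about \<open>F\<close> can rule out admissible
  links that do not exist.\<close>

lemma routingI:
  assumes AB: "A \<union> B = N" "A \<inter> B = {}"
    and \<Theta>: "\<And>a. a \<in> A \<union> X \<Longrightarrow> a \<notin> \<Theta> a \<and> (\<exists>t \<in> \<Theta> a. (a, t) \<in> F)"
    and \<Sigma>: "\<And>b. b \<in> B \<union> Y \<Longrightarrow> b \<notin> \<Sigma> b \<and> (\<exists>s \<in> \<Sigma> b. (s, b) \<in> F)"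
    and chain\<Theta>: "\<And>a a'. a \<in> A \<union> X \<Longrightarrow> a' \<in> A \<union> X \<Longrightarrow> \<Theta> a \<subseteq> \<Theta> a' \<or> \<Theta> a' \<subseteq> \<Theta> a"
    and chain\<Sigma>: "\<And>b b'. b \<in> B \<union> Y \<Longrightarrow> b' \<in> B \<union> Y \<Longrightarrow> \<Sigma> b \<subseteq> \<Sigma> b' \<or> \<Sigma> b' \<subseteq> \<Sigma> b"
    and cross: "\<And>a b. a \<in> A \<union> X \<Longrightarrow> b \<in> B \<union> Y \<Longrightarrow> b \<in> \<Theta> a \<or> a \<in> \<Sigma> b"
    and joined: "\<And>E p q. (\<And>a. a \<in> A \<union> X \<Longrightarrow> \<exists>t \<in> \<Theta> a. (a, t) \<in> F \<and> (a, t) \<in> E) \<Longrightarrow>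
      (\<And>b. b \<in> B \<union> Y \<Longrightarrow> \<exists>s \<in> \<Sigma> b. (s, b) \<in> F \<and> (s, b) \<in> E) \<Longrightarrow>
      (\<And>a. a \<in> A \<union> X \<Longrightarrow> (u, a) \<in> E) \<Longrightarrow> (\<And>b. b \<in> B \<union> Y \<Longrightarrow> (b, u) \<in> E) \<Longrightarrow>
      p \<in> insert u (N \<union> X \<union> Y) \<Longrightarrow> q \<in> insert u (N \<union> X \<union> Y) \<Longrightarrow> joined E k p q"
  shows "routing F u N X Y k"
proof -
  define \<R> where "\<R> = (\<lambda>a. {a} \<times> \<Theta> a) ` (A \<union> X) \<union> (\<lambda>b. \<Sigma> b \<times> {b}) ` (B \<union> Y)"
  have cases: thesis
    if "\<rho> \<in> \<R>" "\<And>a. a \<in> A \<union> X \<Longrightarrow> \<rho> = {a} \<times> \<Theta> a \<Longrightarrow> thesis"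
      "\<And>b. b \<in> B \<union> Y \<Longrightarrow> \<rho> = \<Sigma> b \<times> {b} \<Longrightarrow> thesis" for \<rho> thesis
    using that unfolding \<R>_def by blast
  have unc: "uncrossable \<R>"
    unfolding uncrossable_def
  proof (intro conjI ballI allI impI)
    show "irrefl \<rho>" if "\<rho> \<in> \<R>" for \<rho>
      using that by (rule cases) (use \<Theta> \<Sigma> in \<open>auto simp: irrefl_def\<close>)
    fix \<rho> \<sigma> s t s' t'
    assume *: "\<rho> \<in> \<R>" "\<sigma> \<in> \<R>" "(s, t) \<in> \<rho>" "(s', t') \<in> \<sigma>"
    from *(1) show "(s, t') \<in> \<rho> \<union> \<sigma> \<or> (s', t) \<in> \<rho> \<union> \<sigma>"
    proof (rule cases)
      fix a assume a: "a \<in> A \<union> X" "\<rho> = {a} \<times> \<Theta> a"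
      from *(2) show ?thesis
      proof (rule cases)
        fix a' assume "a' \<in> A \<union> X" "\<sigma> = {a'} \<times> \<Theta> a'"
        then show ?thesis using chain\<Theta>[of a a'] a *(3,4) by auto
      next
        fix b assume "b \<in> B \<union> Y" "\<sigma> = \<Sigma> b \<times> {b}"
        then show ?thesis using cross[of a b] a *(3,4) by auto
      qed
    next
      fix b assume b: "b \<in> B \<union> Y" "\<rho> = \<Sigma> b \<times> {b}"
      from *(2) show ?thesis
      proof (rule cases)
        fix a assume "a \<in> A \<union> X" "\<sigma> = {a} \<times> \<Theta> a"
        then show ?thesis using cross[of a b] b *(3,4) by auto
      next
        fix b' assume "b' \<in> B \<union> Y" "\<sigma> = \<Sigma> b' \<times> {b'}"
        then show ?thesis using chain\<Sigma>[of b b'] b *(3,4) by auto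
      qed
    qed
  qed
  have meet: "\<rho> \<inter> F \<noteq> {}" if "\<rho> \<in> \<R>" for \<rho>
    using that by (rule cases) (use \<Theta> \<Sigma> in auto)
  have joins: "joined (F' \<union> {u} \<times> (A \<union> X) \<union> (B \<union> Y) \<times> {u}) k p q"
    if F': "F' \<subseteq> F" "\<forall>\<rho> \<in> \<R>. \<rho> \<inter> F' \<noteq> {}"
      and pq: "p \<in> insert u (N \<union> X \<union> Y)" "q \<in> insert u (N \<union> X \<union> Y)" for F' p q
  proof (rule joined[OF _ _ _ _ pq])
    fix a assume "a \<in> A \<union> X"
    then have "({a} \<times> \<Theta> a) \<inter> F' \<noteq> {}" using F'(2) unfolding \<R>_def by blast
    then show "\<exists>t \<in> \<Theta> a. (a, t) \<in> F \<and> (a, t) \<in> F' \<union> {u} \<times> (A \<union> X) \<union> (B \<union> Y) \<times> {u}"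
      using F'(1) by blast
  next
    fix b assume "b \<in> B \<union> Y"
    then have "(\<Sigma> b \<times> {b}) \<inter> F' \<noteq> {}" using F'(2) unfolding \<R>_def by blast
    then show "\<exists>s \<in> \<Sigma> b. (s, b) \<in> F \<and> (s, b) \<in> F' \<union> {u} \<times> (A \<union> X) \<union> (B \<union> Y) \<times> {u}"
      using F'(1) by blast
  qed auto
  show ?thesis
    unfolding routing_def
  proof (rule exI[of _ A], rule exI[of _ B], rule exI[of _ \<R>], intro conjI ballI allI impI)
    fix F' p q
    assume "F' \<subseteq> F" "\<forall>\<rho> \<in> \<R>. \<rho> \<inter> F' \<noteq> {}"
      "p \<in> insert u (N \<union> X \<union> Y)" "q \<in> insert u (N \<union> X \<union> Y)"
    then show "joined (F' \<union> {u} \<times> (A \<union> X) \<union> (B \<union> Y) \<times> {u}) k p q" by (rule joins)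
  qed (fact AB unc | erule meet)+
qed

lemma routingE:
  assumes "routing F u N X Y k"
  obtains A B \<R> where "A \<union> B = N" "A \<inter> B = {}" "uncrossable \<R>" "\<And>\<rho>. \<rho> \<in> \<R> \<Longrightarrow> \<rho> \<inter> F \<noteq> {}"
    and "\<And>F' p q. F' \<subseteq> F \<Longrightarrow> (\<And>\<rho>. \<rho> \<in> \<R> \<Longrightarrow> \<rho> \<inter> F' \<noteq> {}) \<Longrightarrow>
      p \<in> insert u (N \<union> X \<union> Y) \<Longrightarrow> q \<in> insert u (N \<union> X \<union> Y) \<Longrightarrow>
      joined (F' \<union> {u} \<times> (A \<union> X) \<union> (B \<union> Y) \<times> {u}) k p q"
proof -
  from assms[unfolded routing_def] obtain A B \<R> where
    raw: "A \<union> B = N" "A \<inter> B = {}" "uncrossable \<R>" "\<forall>\<rho> \<in> \<R>. \<rho> \<inter> F \<noteq> {}"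
    and joins: "\<forall>F' \<subseteq> F. (\<forall>\<rho> \<in> \<R>. \<rho> \<inter> F' \<noteq> {}) \<longrightarrow>
      (\<forall>p \<in> insert u (N \<union> X \<union> Y). \<forall>q \<in> insert u (N \<union> X \<union> Y).
         joined (F' \<union> {u} \<times> (A \<union> X) \<union> (B \<union> Y) \<times> {u}) k p q)"
    by (elim exE conjE) (rule that)
  show thesis
  proof (rule that[of A B \<R>])
    show "\<rho> \<inter> F \<noteq> {}" if "\<rho> \<in> \<R>" for \<rho> using raw(4) that by (rule bspec)
    fix F' p q
    assume "F' \<subseteq> F" "\<And>\<rho>. \<rho> \<in> \<R> \<Longrightarrow> \<rho> \<inter> F' \<noteq> {}"
      "p \<in> insert u (N \<union> X \<union> Y)" "q \<in> insert u (N \<union> X \<union> Y)"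
    then show "joined (F' \<union> {u} \<times> (A \<union> X) \<union> (B \<union> Y) \<times> {u}) k p q"
      by (rule joins[rule_format])
  qed (fact raw)+
qed

lemma uncrossable_converse:
  assumes "uncrossable \<R>"
  shows "uncrossable (converse ` \<R>)"
  unfolding uncrossable_def
proof (intro conjI ballI allI impI)
  show "irrefl \<rho>" if "\<rho> \<in> converse ` \<R>" for \<rho>
    using that assms unfolding uncrossable_def irrefl_def by auto
  fix \<rho> \<sigma> s t s' t'
  assume *: "\<rho> \<in> converse ` \<R>" "\<sigma> \<in> converse ` \<R>" "(s, t) \<in> \<rho>" "(s', t') \<in> \<sigma>"
  then have "\<rho>\<inverse> \<in> \<R>" "\<sigma>\<inverse> \<in> \<R>" "(t, s) \<in> \<rho>\<inverse>" "(t', s') \<in> \<sigma>\<inverse>" by auto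
  then have "(t, s') \<in> \<rho>\<inverse> \<union> \<sigma>\<inverse> \<or> (t', s) \<in> \<rho>\<inverse> \<union> \<sigma>\<inverse>"
    using assms unfolding uncrossable_def by metis
  then show "(s, t') \<in> \<rho> \<union> \<sigma> \<or> (s', t) \<in> \<rho> \<union> \<sigma>" by auto
qed

text \<open>Reversal exchanges \<open>A\<close> with \<open>B\<close> and \<open>X\<close> with
  \<open>Y\<close>, so that only one of two dual situations needs its own argument.\<close>

lemma routing_converse:
  assumes "routing F u N X Y k"
  shows "routing (F\<inverse>) u N Y X k"
  using assms
proof (cases rule: routingE)
  case (1 A B \<R>)
  note AB = 1(1,2) and unc = 1(3) and meet = 1(4) and joined = 1(5)
  have conv: "\<rho>\<inverse> \<inter> F' \<noteq> {} \<longleftrightarrow> \<rho> \<inter> F'\<inverse> \<noteq> {}" for \<rho> F' :: "'a rel" by auto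
  have joins: "joined (F' \<union> {u} \<times> (B \<union> Y) \<union> (A \<union> X) \<times> {u}) k p q"
    if F': "F' \<subseteq> F\<inverse>" "\<forall>\<rho> \<in> converse ` \<R>. \<rho> \<inter> F' \<noteq> {}"
      and pq: "p \<in> insert u (N \<union> Y \<union> X)" "q \<in> insert u (N \<union> Y \<union> X)" for F' p q
  proof -
    have "joined (F'\<inverse> \<union> {u} \<times> (A \<union> X) \<union> (B \<union> Y) \<times> {u}) k q p"
      using F' pq conv by (intro joined) auto
    moreover have "F'\<inverse> \<union> {u} \<times> (A \<union> X) \<union> (B \<union> Y) \<times> {u} = (F' \<union> {u} \<times> (B \<union> Y) \<union> (A \<union> X) \<times> {u})\<inverse>"
      by auto
    ultimately show ?thesis by simp
  qed
  have meet': "\<rho> \<inter> F\<inverse> \<noteq> {}" if "\<rho> \<in> converse ` \<R>" for \<rho> using that meet conv by auto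
  have BA: "B \<union> A = N" "B \<inter> A = {}" using AB by auto
  show ?thesis
    unfolding routing_def
  proof (rule exI[of _ B], rule exI[of _ A], rule exI[of _ "converse ` \<R>"], intro conjI ballI allI impI)
    fix F' p q
    assume "F' \<subseteq> F\<inverse>" "\<forall>\<rho> \<in> converse ` \<R>. \<rho> \<inter> F' \<noteq> {}"
      "p \<in> insert u (N \<union> Y \<union> X)" "q \<in> insert u (N \<union> Y \<union> X)"
    then show "joined (F' \<union> {u} \<times> (B \<union> Y) \<union> (A \<union> X) \<times> {u}) k p q" by (rule joins)
  qed (fact BA uncrossable_converse[OF unc] | erule meet')+
qed

text \<open>\<open>F\<close> stands for the links among \<open>u\<close> and its chosen neighbours
  that use no undirected edge at \<open>u\<close>; \<open>X\<close> will consist of out-neighbours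
  and \<open>Y\<close> of in-neighbours. \<open>N_linked\<close> is all that remains of the absence
  of bridges.\<close>

locale neighbourhood_links =
  fixes F :: "'a rel" and u :: 'a and N X Y :: "'a set"
  assumes fin: "finite N"
    and no_loop: "(v, v) \<notin> F"
    and F_sub: "F \<subseteq> insert u (N \<union> X \<union> Y) \<times> insert u (N \<union> X \<union> Y)"
    and N_disj: "N \<inter> X = {}" "N \<inter> Y = {}" "u \<notin> N"
    and X_disj: "X \<inter> Y = {}" "u \<notin> X" "u \<notin> Y"
    and N_linked: "v \<in> N \<Longrightarrow> \<exists>w. (v, w) \<in> F \<or> (w, v) \<in> F"

section \<open>Splitting the undirected neighbours, and the routings obtained from it\<close>

definition (in neighbourhood_links) P where "P = {v \<in> N. \<exists>x \<in> X. (x, v) \<in> F}"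

text \<open>A vertex of \<open>P\<close> can be reached from \<open>u\<close> through
  \<open>X\<close> and is safe in \<open>B\<close>; a vertex of \<open>Q\<close> can return through
  \<open>Y\<close> and is safe in \<open>A\<close>. Vertices in both sets will go to
  \<open>B\<close>.\<close>

definition (in neighbourhood_links) Q where "Q = {v \<in> N. \<exists>y \<in> Y. (v, y) \<in> F}"

text \<open>
  \<open>B\<close> is chosen minimal such that every vertex of \<open>A\<close> has a suitable out-neighbour. Removing
  \<open>b\<close> from \<open>B\<close> fails either because some vertex of \<open>A\<close> needs \<open>b\<close>, or because \<open>b\<close> itself would be
  a vertex of \<open>A\<close> without such an out-neighbour.
\<close>
lemma (in neighbourhood_links) split:
  obtains A B where "A \<union> B = N" "A \<inter> B = {}" "P \<subseteq> B" "Q - P \<subseteq> A"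
    and "\<And>a. a \<in> A \<Longrightarrow> \<exists>w \<in> B \<union> Q \<union> X \<union> Y \<union> {u}. (a, w) \<in> F"
    and "\<And>b. b \<in> B \<Longrightarrow> \<exists>s. (s, b) \<in> F"
    and "\<And>b. b \<in> B \<Longrightarrow> b \<in> P \<or> (\<exists>a \<in> A. (a, b) \<in> F) \<or>
      (\<forall>w \<in> B \<union> Q \<union> X \<union> Y \<union> {u}. (b, w) \<notin> F)"
proof -
  \<comment> \<open>A vertex of \<open>In\<close> can reach \<open>u\<close> only along its own edge
    and must lie in \<open>B\<close>; dually, a vertex of \<open>Out\<close> must lie in
    \<open>A\<close>.\<close>
  define In where "In = {v \<in> N. \<forall>w. (v, w) \<notin> F}"
  define Out where "Out = {v \<in> N. \<forall>w. (w, v) \<notin> F}"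
  let ?W = "\<lambda>B. B \<union> Q \<union> X \<union> Y \<union> {u}"
  define ok where "ok B \<longleftrightarrow> B \<subseteq> N \<and> In \<union> P \<subseteq> B \<and> B \<inter> (Out \<union> (Q - P)) = {} \<and>
    (\<forall>a \<in> N - B. \<exists>w \<in> ?W B. (a, w) \<in> F)" for B
  \<comment> \<open>The largest candidate for \<open>B\<close>. A vertex of \<open>Out\<close> has
    an outgoing link by \<open>N_linked\<close>, and the end of that link is not in
    \<open>Out\<close> because it is entered.\<close>
  have "ok (N - (Out \<union> (Q - P)))"
    unfolding ok_def
  proof (intro conjI ballI)
    show "In \<union> P \<subseteq> N - (Out \<union> (Q - P))"
      using N_linked unfolding In_def Out_def P_def Q_def by blast
    fix a assume a: "a \<in> N - (N - (Out \<union> (Q - P)))"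
    show "\<exists>w \<in> ?W (N - (Out \<union> (Q - P))). (a, w) \<in> F"
    proof (cases "a \<in> Q")
      case False
      then have "a \<in> Out" using a by blast
      then obtain w where w: "(a, w) \<in> F" using N_linked a unfolding Out_def by blast
      then have "w \<in> ?W N" "w \<notin> Out" using F_sub unfolding Out_def by auto
      then show ?thesis using w by blast
    qed (auto simp: Q_def)
  qed auto
  then obtain B where "ok B" and min: "\<And>C. ok C \<Longrightarrow> card B \<le> card C"
    using ex_has_least_nat[of ok _ card] by blast
  then have ok: "B \<subseteq> N" "In \<union> P \<subseteq> B" "B \<inter> (Out \<union> (Q - P)) = {}"
    "\<And>a. a \<in> N - B \<Longrightarrow> \<exists>w \<in> ?W B. (a, w) \<in> F"
    unfolding ok_def by auto
  show ?thesis
  proof (rule that[of "N - B" B])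
    show "\<exists>s. (s, b) \<in> F" if "b \<in> B" for b
      using ok that unfolding Out_def by blast
    show "b \<in> P \<or> (\<exists>a \<in> N - B. (a, b) \<in> F) \<or> (\<forall>w \<in> ?W B. (b, w) \<notin> F)" if b: "b \<in> B" for b
    proof (rule ccontr)
      assume contra: "\<not> ?thesis"
      then obtain w where w: "w \<in> ?W B" "(b, w) \<in> F" by blast
      have "ok (B - {b})"
        unfolding ok_def
      proof (intro conjI ballI)
        show "In \<union> P \<subseteq> B - {b}" using ok contra w unfolding In_def by blast
        fix a assume a: "a \<in> N - (B - {b})"
        show "\<exists>w \<in> ?W (B - {b}). (a, w) \<in> F"
        proof (cases "a = b")
          case True
          then show ?thesis using w no_loop by blast
        next
          case False
          then have "a \<in> N - B" using a by blast
          then show ?thesis using ok(4)[of a] contra by blast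
        qed
      qed (use ok in auto)
      moreover have "card (B - {b}) < card B"
        using b ok fin finite_subset card_Diff1_less by metis
      ultimately show False using min[of "B - {b}"] by linarith
    qed
    show "Q - P \<subseteq> N - B" using ok(3) unfolding Q_def by blast
  qed (use ok in auto)
qed

text \<open>Two links suffice to reach \<open>u\<close>. A vertex of \<open>B\<close> that is not
  entered from \<open>A\<close> or \<open>u\<close> is entered from some \<open>s\<close> in
  \<open>B\<close>; as \<open>s\<close> has a link into \<open>B\<close>, minimality provides a link
  from \<open>A\<close> to \<open>s\<close>. So three links suffice from \<open>u\<close>, and 2 + 3
  = 5.\<close>

lemma (in neighbourhood_links) routing_5:
  assumes "X = {}" "Y = {}"
  shows "routing F u N {} {} 5"
proof (cases rule: split)
  case (1 A B)
  note AB = 1(1,2)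
  have "P = {}" "Q = {}" unfolding P_def Q_def using assms by auto
  then have out: "\<exists>w \<in> B \<union> {u}. (a, w) \<in> F" if "a \<in> A" for a
    using 1(5)[OF that] assms by simp
  define B1 where "B1 = {b \<in> B. \<exists>s \<in> A \<union> {u}. (s, b) \<in> F}"
  define \<Sigma> where "\<Sigma> b = (if b \<in> B1 then A \<union> {u} else A \<union> {u} \<union> B1)" for b
  have disj: "u \<notin> A" "u \<notin> B" using N_disj AB by auto
  have served: "\<exists>s \<in> \<Sigma> b. (s, b) \<in> F" if b: "b \<in> B" for b
  proof -
    obtain s where s: "(s, b) \<in> F" using 1(6) b by blast
    then have "s \<in> insert u (A \<union> B)" using F_sub assms AB by auto
    moreover have "s \<in> B1" if "s \<in> B" "b \<notin> B1"
      using 1(7)[OF that(1)] s b that(1) \<open>P = {}\<close> unfolding B1_def by blast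
    ultimately show ?thesis using s b unfolding \<Sigma>_def B1_def by auto
  qed
  show ?thesis
  proof (rule routingI[where A = A and B = B and \<Theta> = "\<lambda>_. B \<union> {u}" and \<Sigma> = \<Sigma>])
    show "b \<notin> \<Sigma> b \<and> (\<exists>s \<in> \<Sigma> b. (s, b) \<in> F)" if b: "b \<in> B \<union> {}" for b
      using served[of b] b disj AB unfolding \<Sigma>_def by auto
    show "a \<notin> B \<union> {u} \<and> (\<exists>t \<in> B \<union> {u}. (a, t) \<in> F)" if "a \<in> A \<union> {}" for a
      using out[of a] that disj AB by auto
    show "\<Sigma> b \<subseteq> \<Sigma> b' \<or> \<Sigma> b' \<subseteq> \<Sigma> b" for b b' unfolding \<Sigma>_def by auto
    fix E p q
    assume E: "\<And>a. a \<in> A \<union> {} \<Longrightarrow> \<exists>t \<in> B \<union> {u}. (a, t) \<in> F \<and> (a, t) \<in> E"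
      "\<And>b. b \<in> B \<union> {} \<Longrightarrow> \<exists>s \<in> \<Sigma> b. (s, b) \<in> F \<and> (s, b) \<in> E"
      "\<And>a. a \<in> A \<union> {} \<Longrightarrow> (u, a) \<in> E" "\<And>b. b \<in> B \<union> {} \<Longrightarrow> (b, u) \<in> E"
    assume pq: "p \<in> insert u (N \<union> {} \<union> {})" "q \<in> insert u (N \<union> {} \<union> {})"
    have toB: "joined E 1 b u" if "b \<in> B \<union> {u}" for b using E(4) that joined_1[of b u E] by auto
    have to: "joined E 2 p u"
    proof (cases "p \<in> A")
      case True
      then obtain t where t: "t \<in> B \<union> {u}" "(p, t) \<in> E" using E(1) by blast
      show ?thesis by (rule joined_step[OF t(2) toB[OF t(1)]]) simp
    next
      case False
      then show ?thesis using pq AB joined_mono[OF toB[of p], of 2] by auto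
    qed
    have fromA: "joined E 1 u a" if "a \<in> A \<union> {u}" for a using E(3) that joined_1[of u a E] by auto
    have fromB1: "joined E 2 u b" if b: "b \<in> B1" for b
    proof -
      have "b \<in> B" using b unfolding B1_def by simp
      then obtain s where s: "s \<in> A \<union> {u}" "(s, b) \<in> E"
        using E(2)[of b] b unfolding \<Sigma>_def by auto
      show ?thesis by (rule joined_step_right[OF fromA[OF s(1)] s(2)]) simp
    qed
    have "joined E 3 u q"
    proof (cases "q \<in> B")
      case True
      then obtain s where s: "s \<in> A \<union> {u} \<union> B1" "(s, q) \<in> E"
        using E(2)[of q] unfolding \<Sigma>_def by (auto split: if_splits)
      then have "joined E 2 u s"
        using joined_mono[OF fromA[of s], of 2] fromB1[of s] by auto
      from joined_step_right[OF this s(2)] show ?thesis by simp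
    next
      case False
      then show ?thesis using pq AB joined_mono[OF fromA[of q], of 3] by auto
    qed
    then show "joined E 5 p q" using joined_trans_le[OF to] by simp
  qed (use AB in auto)
qed

text \<open>By symmetry, a vertex \<open>b\<close> of \<open>B\<close> entered from \<open>B\<close>
  also has a link into \<open>B\<close>, so minimality provides a link from \<open>A\<close> to
  \<open>b\<close> itself. Now two links suffice in both directions.\<close>

lemma (in neighbourhood_links) routing_4:
  assumes "X = {}" "Y = {}" "sym F" "\<And>v. (v, u) \<notin> F"
  shows "routing F u N {} {} 4"
proof (cases rule: split)
  case (1 A B)
  note AB = 1(1,2)
  have PQ: "P = {}" "Q = {}" unfolding P_def Q_def using assms by auto
  have out: "\<exists>w \<in> B. (a, w) \<in> F" if "a \<in> A" for a
    using 1(5)[OF that] assms PQ by simp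
  have served: "\<exists>s \<in> A. (s, b) \<in> F" if b: "b \<in> B" for b
  proof -
    obtain s where s: "(s, b) \<in> F" using 1(6) b by blast
    then have bs: "(b, s) \<in> F" using assms(3) by (simp add: symD)
    then have "s \<in> A \<union> B" using F_sub assms AB by auto
    then show "\<exists>s \<in> A. (s, b) \<in> F" using 1(7)[OF b] s bs PQ by blast
  qed
  show ?thesis
  proof (rule routingI[where A = A and B = B and \<Theta> = "\<lambda>_. B" and \<Sigma> = "\<lambda>_. A"])
    show "b \<notin> A \<and> (\<exists>s \<in> A. (s, b) \<in> F)" if "b \<in> B \<union> {}" for b
      using served[of b] that AB by auto
    show "a \<notin> B \<and> (\<exists>t \<in> B. (a, t) \<in> F)" if "a \<in> A \<union> {}" for a
      using out[of a] that AB by auto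
    fix E p q
    assume E: "\<And>a. a \<in> A \<union> {} \<Longrightarrow> \<exists>t \<in> B. (a, t) \<in> F \<and> (a, t) \<in> E"
      "\<And>b. b \<in> B \<union> {} \<Longrightarrow> \<exists>s \<in> A. (s, b) \<in> F \<and> (s, b) \<in> E"
      "\<And>a. a \<in> A \<union> {} \<Longrightarrow> (u, a) \<in> E" "\<And>b. b \<in> B \<union> {} \<Longrightarrow> (b, u) \<in> E"
    assume pq: "p \<in> insert u (N \<union> {} \<union> {})" "q \<in> insert u (N \<union> {} \<union> {})"
    have toB: "joined E 1 b u" if "b \<in> B \<union> {u}" for b using E(4) that joined_1[of b u E] by auto
    have to: "joined E 2 p u"
    proof (cases "p \<in> A")
      case True
      then obtain t where t: "t \<in> B \<union> {u}" "(p, t) \<in> E" using E(1) by blast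
      show ?thesis by (rule joined_step[OF t(2) toB[OF t(1)]]) simp
    next
      case False
      then show ?thesis using pq AB joined_mono[OF toB[of p], of 2] by auto
    qed
    have fromA: "joined E 1 u a" if "a \<in> A \<union> {u}" for a using E(3) that joined_1[of u a E] by auto
    have "joined E 2 u q"
    proof (cases "q \<in> B")
      case True
      then obtain s where s: "s \<in> A \<union> {u}" "(s, q) \<in> E" using E(2) by blast
      show ?thesis by (rule joined_step_right[OF fromA[OF s(1)] s(2)]) simp
    next
      case False
      then show ?thesis using pq AB joined_mono[OF fromA[of q], of 2] by auto
    qed
    then show "joined E 4 p q" using joined_trans_le[OF to] by simp
  qed (use AB in auto)
qed

text \<open>Links to \<open>u\<close>: 1 from \<open>B\<close> and \<open>y\<close>, 2 from
  \<open>A2\<close> and \<open>x\<close>, 3 from the rest of \<open>A\<close>. Links from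
  \<open>u\<close>: 1 to \<open>A\<close> and \<open>x\<close>, 2 to \<open>P\<close> and
  \<open>B1\<close>, 3 to \<open>B2\<close> and \<open>y\<close>, 4 to the rest of \<open>B\<close>,
  which is entered only from \<open>y\<close>. The sum 3 + 4 is the one to avoid. If
  \<open>good\<close> holds, \<open>y\<close> is only 2 links from \<open>u\<close> and 4 does not
  occur; otherwise there is a walk that bypasses \<open>u\<close>.\<close>

lemma (in neighbourhood_links) routing_in_out:
  assumes X: "X = {x}" and Y: "Y = {y}"
    and x_out: "\<exists>w. (x, w) \<in> F" and y_in: "\<exists>w. (w, y) \<in> F"
  shows "routing F u N {x} {y} 6"
proof (cases rule: split)
  case (1 A B)
  note AB = 1(1,2) and PB = 1(3) and QA = 1(4) and out = 1(5) and min = 1(7)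
  have neq: "x \<noteq> y" "x \<noteq> u" "y \<noteq> u" "x \<notin> A" "x \<notin> B" "y \<notin> A" "y \<notin> B" "u \<notin> A" "u \<notin> B"
    using N_disj X_disj X Y AB by auto
  have V: "s \<in> insert u (A \<union> B \<union> {x, y})" "t \<in> insert u (A \<union> B \<union> {x, y})" if "(s, t) \<in> F" for s t
    using F_sub that X Y AB by auto
  have inP: "b \<in> P" if "(x, b) \<in> F" "b \<in> A \<union> B" for b
    using that X AB unfolding P_def by auto
  have inQ: "a \<in> Q" if "(a, y) \<in> F" "a \<in> A \<union> B" for a
    using that Y AB unfolding Q_def by auto
  have Px: "(x, b) \<in> F" if "b \<in> P" for b using that X unfolding P_def by auto
  have Qy: "(a, y) \<in> F" if "a \<in> Q" for a using that Y unfolding Q_def by auto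
  define B1 where "B1 = {b \<in> B - P. \<exists>s \<in> A \<union> {u}. (s, b) \<in> F}"
  define B2 where "B2 = {b \<in> B - P - B1. \<exists>s \<in> P \<union> B1. (s, b) \<in> F}"
  define A2 where "A2 = {a \<in> A. \<exists>w \<in> B \<union> {y, u}. (a, w) \<in> F}"
  define good where "good \<longleftrightarrow> (\<exists>s \<in> A \<union> {x, u}. (s, y) \<in> F)"
  define \<Theta> where "\<Theta> a = (if a \<in> A2 \<union> {x} then B \<union> {y, u} else B \<union> {y, u, x} \<union> (Q \<inter> A))" for a
  \<comment> \<open>The values are nested as uncrossing demands. A vertex of \<open>P\<close> has to
    be entered from \<open>x\<close> itself, on which the walk bypassing \<open>u\<close>
    relies.\<close>
  define \<Sigma> where "\<Sigma> b = (if b \<in> P then {x}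
    else if b \<in> B1 \<or> b = y \<and> good then A \<union> {x, u}
    else if b \<in> B2 \<or> b = y then A \<union> {x, u} \<union> P \<union> B1 else A \<union> {x, u} \<union> P \<union> B1 \<union> {y})" for b
  have QA2: "Q \<inter> A \<subseteq> A2" using Qy unfolding A2_def by auto
  have B12: "B1 \<subseteq> B" "B2 \<subseteq> B" "B1 \<inter> P = {}" unfolding B1_def B2_def by auto
  have outx: "\<exists>t \<in> B \<union> {y, u}. (x, t) \<in> F"
  proof -
    obtain t where t: "(x, t) \<in> F" using x_out by blast
    moreover have "t \<noteq> x" using t no_loop by auto
    ultimately show ?thesis using V(2)[OF t] inP PB by blast
  qed
  have served: "\<exists>s \<in> \<Sigma> b. (s, b) \<in> F" if b: "b \<in> B" for b
  proof -
    obtain s where s: "(s, b) \<in> F" using 1(6) b by blast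
    have "s \<in> P \<union> B1" if sB: "s \<in> B"
      using min[OF sB] s b sB unfolding B1_def by blast
    then have "s \<in> A \<union> {x, u} \<union> P \<union> B1 \<union> {y}" using V(1)[OF s] by blast
    then consider "b \<in> P" | "b \<notin> P" "s \<in> A \<union> {u}" | "b \<notin> P" "s \<in> P \<union> B1" | "b \<notin> P" "s = y"
      using inP[of b] s b by blast
    then show ?thesis
    proof cases
      case 1
      then show ?thesis using Px unfolding \<Sigma>_def by simp
    next
      case 2
      then have "b \<in> B1" using s b unfolding B1_def by blast
      then show ?thesis using 2 s unfolding \<Sigma>_def by auto
    next
      case 3
      then have "b \<in> B1 \<union> B2" using s b unfolding B2_def by blast
      then consider "b \<in> B1" | "b \<notin> B1" "b \<in> B2" by blast
      then show ?thesis
      proof cases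
        case 1
        then show ?thesis using \<open>b \<notin> P\<close> unfolding \<Sigma>_def B1_def by auto
      next
        case 2
        then show ?thesis using 3 s neq b unfolding \<Sigma>_def by auto
      qed
    next
      case 4
      then consider "b \<in> B1" | "b \<notin> B1" "b \<in> B2" | "b \<notin> B1" "b \<notin> B2" by blast
      then show ?thesis
      proof cases
        case 1
        then show ?thesis using \<open>b \<notin> P\<close> unfolding \<Sigma>_def B1_def by auto
      next
        case 2
        then obtain r where "r \<in> P \<union> B1" "(r, b) \<in> F" unfolding B2_def by blast
        then show ?thesis using 2 4 neq b unfolding \<Sigma>_def by auto
      next
        case 3
        then show ?thesis using 4 s neq b unfolding \<Sigma>_def by auto
      qed
    qed
  qed
  have y_served: "\<exists>s \<in> \<Sigma> y. (s, y) \<in> F"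
  proof (cases good)
    case True
    then show ?thesis using neq PB B12 unfolding \<Sigma>_def good_def by auto
  next
    case False
    obtain s where s: "(s, y) \<in> F" using y_in by blast
    then have "s \<noteq> y" using no_loop by auto
    then have "s \<in> B" using V(1)[OF s] False s unfolding good_def by blast
    then have "s \<in> P" using inQ[OF s] QA AB by blast
    then show ?thesis using s False neq PB B12 unfolding \<Sigma>_def by auto
  qed
  have A_served: "\<exists>t \<in> \<Theta> a. (a, t) \<in> F" if a: "a \<in> A" for a
  proof -
    obtain w where w: "w \<in> B \<union> Q \<union> {x} \<union> {y} \<union> {u}" "(a, w) \<in> F" using out[OF a] X Y by blast
    show ?thesis
    proof (cases "a \<in> A2")
      case True
      then show ?thesis unfolding \<Theta>_def A2_def by auto
    next
      case False
      have "w \<in> B \<union> {y, u, x} \<union> (Q \<inter> A)" using w V(2)[OF w(2)] by blast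
      then show ?thesis using w(2) False a neq unfolding \<Theta>_def by auto
    qed
  qed
  show ?thesis
  proof (rule routingI[where A = A and B = B and \<Theta> = \<Theta> and \<Sigma> = \<Sigma>])
    show "b \<notin> \<Sigma> b \<and> (\<exists>s \<in> \<Sigma> b. (s, b) \<in> F)" if b: "b \<in> B \<union> {y}" for b
    proof
      show "b \<notin> \<Sigma> b" using b neq AB PB B12 unfolding \<Sigma>_def by auto
      show "\<exists>s \<in> \<Sigma> b. (s, b) \<in> F" using b served y_served by auto
    qed
    show "a \<notin> \<Theta> a \<and> (\<exists>t \<in> \<Theta> a. (a, t) \<in> F)" if a: "a \<in> A \<union> {x}" for a
    proof
      show "a \<notin> \<Theta> a" using a neq AB QA2 unfolding \<Theta>_def by auto
      show "\<exists>t \<in> \<Theta> a. (a, t) \<in> F"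
      proof (cases "a = x")
        case True
        then show ?thesis using outx unfolding \<Theta>_def by simp
      next
        case False
        then show ?thesis using a A_served[of a] by simp
      qed
    qed
    show "\<Theta> a \<subseteq> \<Theta> a' \<or> \<Theta> a' \<subseteq> \<Theta> a" for a a' unfolding \<Theta>_def by auto
    show "\<Sigma> b \<subseteq> \<Sigma> b' \<or> \<Sigma> b' \<subseteq> \<Sigma> b" for b b' unfolding \<Sigma>_def by auto
    show "b \<in> \<Theta> a \<or> a \<in> \<Sigma> b" if "b \<in> B \<union> {y}" for a b using that unfolding \<Theta>_def by auto
    fix E p q
    assume \<Theta>E: "\<And>a. a \<in> A \<union> {x} \<Longrightarrow> \<exists>t \<in> \<Theta> a. (a, t) \<in> F \<and> (a, t) \<in> E"
      and \<Sigma>E: "\<And>b. b \<in> B \<union> {y} \<Longrightarrow> \<exists>s \<in> \<Sigma> b. (s, b) \<in> F \<and> (s, b) \<in> E"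
      and uA: "\<And>a. a \<in> A \<union> {x} \<Longrightarrow> (u, a) \<in> E" and Bu: "\<And>b. b \<in> B \<union> {y} \<Longrightarrow> (b, u) \<in> E"
    assume "p \<in> insert u (N \<union> {x} \<union> {y})" "q \<in> insert u (N \<union> {x} \<union> {y})"
    then have pq: "p \<in> insert u (A \<union> B \<union> {x, y})" "q \<in> insert u (A \<union> B \<union> {x, y})" using AB by auto
    have to1: "joined E 1 b u" if "b \<in> B \<union> {y, u}" for b using Bu[of b] that joined_1[of b u E] by auto
    have to2: "joined E 2 a u" if a: "a \<in> A2 \<union> {x}" for a
    proof -
      have "a \<in> A \<union> {x}" using a unfolding A2_def by auto
      then obtain t where t: "t \<in> B \<union> {y, u}" "(a, t) \<in> E"
        using \<Theta>E[of a] a unfolding \<Theta>_def by auto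
      show ?thesis by (rule joined_step[OF t(2) to1[OF t(1)]]) simp
    qed
    have to3: "joined E 3 a u" if a: "a \<in> A - A2" for a
    proof -
      obtain t where t: "t \<in> B \<union> {y, u, x} \<union> (Q \<inter> A)" "(a, t) \<in> E"
        using \<Theta>E[of a] a neq unfolding \<Theta>_def by (auto split: if_splits)
      then have "joined E 2 t u"
        using joined_mono[OF to1[of t], of 2] to2[of t] QA2 by auto
      from joined_step[OF t(2) this] show ?thesis by simp
    qed
    have to_cases: "joined E 2 p u \<or> p \<in> A - A2 \<and> joined E 3 p u"
      using pq(1) joined_mono[OF to1[of p], of 2] to2[of p] to3[of p] by auto
    have from1: "joined E 1 u a" if "a \<in> A \<union> {x, u}" for a using uA[of a] that joined_1[of u a E] by auto
    have from2: "joined E 2 u b" if b: "b \<in> P \<union> B1 \<or> b = y \<and> good" for b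
    proof -
      have "b \<in> B \<union> {y}" using b PB B12 by auto
      then obtain s where s: "s \<in> A \<union> {x, u}" "(s, b) \<in> E"
        using \<Sigma>E[of b] b unfolding \<Sigma>_def by (auto split: if_splits)
      show ?thesis by (rule joined_step_right[OF from1[OF s(1)] s(2)]) simp
    qed
    have from2': "joined E 2 u b" if "b \<in> A \<union> {x, u} \<union> P \<union> B1" for b
      using that joined_mono[OF from1[of b], of 2] from2[of b] by auto
    have from3: "joined E 3 u b" if b: "b \<in> P \<union> B1 \<union> B2 \<union> {y}" for b
    proof -
      have bB: "b \<in> B \<union> {y}" using b PB B12 by auto
      then obtain s where s: "s \<in> A \<union> {x, u} \<union> P \<union> B1" "(s, b) \<in> E"
        using \<Sigma>E[of b] b unfolding \<Sigma>_def by (auto split: if_splits)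
      from joined_step_right[OF from2'[OF s(1)] s(2)] show ?thesis by simp
    qed
    have via_y: "(y, b) \<in> E" if b: "b \<in> B - P - B1 - B2" for b
    proof -
      obtain s where s: "s \<in> A \<union> {x, u} \<union> P \<union> B1 \<union> {y}" "(s, b) \<in> F" "(s, b) \<in> E"
        using \<Sigma>E[of b] b neq unfolding \<Sigma>_def by (auto split: if_splits)
      have "s \<notin> A \<union> {u}" using s(2) b unfolding B1_def by blast
      moreover have "s \<noteq> x" using s(2) b inP by blast
      moreover have "s \<notin> P \<union> B1" using s(2) b unfolding B2_def by blast
      ultimately show ?thesis using s by blast
    qed
    have from_cases: "joined E 3 u q \<or> q \<in> B - P - B1 - B2 \<and> \<not> good \<and> joined E 4 u q"
    proof (cases "q \<in> B - P - B1 - B2")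
      case True
      note yq = via_y[OF True]
      show ?thesis
      proof (cases good)
        case True
        then have "joined E 2 u y" using from2 by simp
        from joined_step_right[OF this yq] show ?thesis by simp
      next
        case False
        have "joined E 3 u y" using from3 by simp
        from joined_step_right[OF this yq] show ?thesis using False True by simp
      qed
    next
      case False
      then show ?thesis using pq(2) joined_mono[OF from1[of q], of 3] from3[of q] by auto
    qed
    show "joined E 6 p q"
    proof (cases "p \<in> A - A2 \<and> q \<in> B - P - B1 - B2 \<and> \<not> good")
      case False
      then consider "joined E 2 p u" "joined E 4 u q" | "joined E 3 p u" "joined E 3 u q"
        using to_cases from_cases joined_mono[of E 2 p u 3] joined_mono[of E 3 u q 4] by auto
      then show ?thesis
        by cases (use joined_trans_le in fastforce)+
    next
      case True
      \<comment> \<open>Without \<open>good\<close>, no vertex of \<open>Q\<close> lies in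
        \<open>A\<close>, so \<open>p\<close> keeps a link to \<open>x\<close>; and \<open>y\<close>
        is entered from some \<open>s\<close> in \<open>P\<close>, which is entered from
        \<open>x\<close>. The walk \<open>p\<close>, \<open>x\<close>, \<open>s\<close>,
        \<open>y\<close>, \<open>q\<close> has four links.\<close>
      then have p: "p \<in> A" "p \<notin> A2" and q: "q \<in> B - P - B1 - B2" and bad: "\<not> good" by auto
      have "\<Theta> p = B \<union> {y, u, x} \<union> (Q \<inter> A)" using p neq unfolding \<Theta>_def by auto
      then obtain t where t: "t \<in> B \<union> {y, u, x} \<union> (Q \<inter> A)" "(p, t) \<in> F" "(p, t) \<in> E"
        using \<Theta>E[of p] p(1) by blast
      have "t \<notin> B \<union> {y, u}" using t(2) p unfolding A2_def by blast
      moreover have "t \<notin> Q \<inter> A" using bad Qy unfolding good_def by blast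
      ultimately have px: "(p, x) \<in> E" using t by blast
      have "\<Sigma> y = A \<union> {x, u} \<union> P \<union> B1" using bad neq PB B12 unfolding \<Sigma>_def by auto
      then obtain s where s: "s \<in> A \<union> {x, u} \<union> P \<union> B1" "(s, y) \<in> F" "(s, y) \<in> E"
        using \<Sigma>E[of y] by blast
      have "s \<notin> A \<union> {x, u}" using s(2) bad unfolding good_def by blast
      then have "s \<in> B" using s(1) PB B12 by blast
      then have sP: "s \<in> P" using inQ[OF s(2)] QA AB by blast
      then have xs: "(x, s) \<in> E" using \<Sigma>E[of s] PB unfolding \<Sigma>_def by auto
      have "joined E 1 y q" using joined_1[OF via_y[OF q]] .
      from joined_step[OF s(3) this, of 2] have "joined E 2 s q" by simp
      from joined_step[OF xs this, of 3] have "joined E 3 x q" by simp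
      from joined_step[OF px this, of 6] show ?thesis by simp
    qed
  qed (use AB in auto)
qed

text \<open>Again up to 3 links lead to \<open>u\<close> and up to 4 from \<open>u\<close>.
  \<open>Y_entered\<close> yields a vertex \<open>yg\<close> of \<open>Y\<close> entered from
  \<open>A\<close> or \<open>u\<close>; if the other vertex of \<open>Y\<close> is not entered like
  this, all its incoming links start at \<open>yg\<close>. This provides a walk of four links for
  the pairs with sum 3 + 4.\<close>

lemma (in neighbourhood_links) routing_two_in:
  assumes X: "X = {}" and Y: "Y = {y1, y2}"
    and Y_in: "\<And>y. y \<in> Y \<Longrightarrow> \<exists>w. (w, y) \<in> F" and Y_entered: "\<exists>y \<in> Y. \<exists>w. w \<notin> Y \<and> (w, y) \<in> F"
  shows "routing F u N {} Y 6"
proof (cases rule: split)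
  case (1 A B)
  note AB = 1(1,2)
  have "P = {}" unfolding P_def using X by simp
  then have QA: "Q \<subseteq> A" and out: "\<And>a. a \<in> A \<Longrightarrow> \<exists>w \<in> B \<union> Q \<union> Y \<union> {u}. (a, w) \<in> F"
    and min: "\<And>b. b \<in> B \<Longrightarrow> (\<exists>a \<in> A. (a, b) \<in> F) \<or> (\<forall>w \<in> B \<union> Q \<union> Y \<union> {u}. (b, w) \<notin> F)"
    using 1(4,5,7) X by auto
  have neq: "u \<notin> A" "u \<notin> B" "u \<notin> Y" "A \<inter> Y = {}" "B \<inter> Y = {}" using N_disj X_disj AB by auto
  have V: "s \<in> insert u (A \<union> B \<union> Y)" "t \<in> insert u (A \<union> B \<union> Y)" if "(s, t) \<in> F" for s t
    using F_sub that X AB by auto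
  have inQ: "a \<in> Q" if "(a, y) \<in> F" "y \<in> Y" "a \<in> A \<union> B" for a y
    using that AB unfolding Q_def by auto
  have Qout: "\<exists>y \<in> Y. (a, y) \<in> F" if "a \<in> Q" for a using that unfolding Q_def by auto
  define Yg where "Yg = {y \<in> Y. \<exists>s \<in> A \<union> {u}. (s, y) \<in> F}"
  define B1 where "B1 = {b \<in> B. \<exists>s \<in> A \<union> {u}. (s, b) \<in> F}"
  define B2 where "B2 = {b \<in> B - B1. \<exists>s \<in> B1 \<union> Yg. (s, b) \<in> F}"
  define A2 where "A2 = {a \<in> A - Q. \<exists>w \<in> B \<union> Y \<union> {u}. (a, w) \<in> F}"
  \<comment> \<open>For \<open>a\<close> in \<open>Q\<close> only links into \<open>Y\<close> are
    admissible, so that the walk bypassing \<open>u\<close> can continue from \<open>Q\<close> to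
    \<open>Y\<close>.\<close>
  define \<Theta> where "\<Theta> a = (if a \<in> Q then Y else if a \<in> A2 then B \<union> Y \<union> {u} else B \<union> Y \<union> {u} \<union> Q)" for a
  define \<Sigma> where "\<Sigma> b = (if b \<in> B1 \<union> Yg then A \<union> {u}
    else if b \<in> B2 \<union> Y then A \<union> {u} \<union> B1 \<union> Yg else A \<union> {u} \<union> B1 \<union> Y)" for b
  have sub: "B1 \<subseteq> B" "B2 \<subseteq> B" "Yg \<subseteq> Y" "A2 \<subseteq> A - Q" "Q \<subseteq> A"
    using QA unfolding B1_def B2_def Yg_def A2_def by auto
  have enter: "w \<in> Y" if "(w, y) \<in> F" "y \<in> Y - Yg" for w y
  proof -
    have "w \<notin> A \<union> {u}" using that unfolding Yg_def by blast
    moreover have "w \<notin> B" using inQ[OF that(1)] that(2) QA AB by blast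
    ultimately show ?thesis using V(1)[OF that(1)] by blast
  qed
  obtain yg where yg: "yg \<in> Yg" using Y_entered enter by blast
  have Yg_unique: "Y = {yg, y}" if "y \<in> Y - Yg" for y
    using that yg sub(3) Y by auto
  have Y_served: "\<exists>s \<in> \<Sigma> y. (s, y) \<in> F" if y: "y \<in> Y" for y
  proof (cases "y \<in> Yg")
    case True
    then show ?thesis unfolding \<Sigma>_def Yg_def by auto
  next
    case False
    obtain w where w: "(w, y) \<in> F" using Y_in y by blast
    then have "w \<in> Y" "w \<noteq> y" using enter False y no_loop by auto
    then have "w = yg" using Yg_unique[of y] False y by auto
    then show ?thesis using w yg False y neq sub unfolding \<Sigma>_def by auto
  qed
  have B_served: "\<exists>s \<in> \<Sigma> b. (s, b) \<in> F" if b: "b \<in> B" for b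
  proof (cases "b \<in> B1 \<union> B2")
    case True
    then show ?thesis
    proof (cases "b \<in> B1")
      case True
      then show ?thesis unfolding \<Sigma>_def B1_def by auto
    next
      case False
      with True have "b \<in> B2" by simp
      then obtain s where "s \<in> B1 \<union> Yg" "(s, b) \<in> F" unfolding B2_def by blast
      then show ?thesis using False b neq sub \<open>b \<in> B2\<close> unfolding \<Sigma>_def by auto
    qed
  next
    case False
    obtain s where s: "(s, b) \<in> F" using 1(6) b by blast
    have "s \<in> B1" if sB: "s \<in> B"
      using min[OF sB] s b sB unfolding B1_def by blast
    then have "s \<in> A \<union> {u} \<union> B1 \<union> Y" using V(1)[OF s] by blast
    then show ?thesis using s False b neq sub unfolding \<Sigma>_def by auto
  qed
  have A_served: "\<exists>t \<in> \<Theta> a. (a, t) \<in> F" if a: "a \<in> A" for a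
  proof (cases "a \<in> Q")
    case True
    then show ?thesis using Qout unfolding \<Theta>_def by simp
  next
    case False
    obtain w where "w \<in> B \<union> Q \<union> Y \<union> {u}" "(a, w) \<in> F" using out[OF a] by blast
    then show ?thesis using False unfolding \<Theta>_def A2_def by auto
  qed
  show ?thesis
  proof (rule routingI[where A = A and B = B and \<Theta> = \<Theta> and \<Sigma> = \<Sigma>])
    show "b \<notin> \<Sigma> b \<and> (\<exists>s \<in> \<Sigma> b. (s, b) \<in> F)" if b: "b \<in> B \<union> Y" for b
    proof
      show "b \<notin> \<Sigma> b" using b neq AB sub unfolding \<Sigma>_def by auto
      show "\<exists>s \<in> \<Sigma> b. (s, b) \<in> F" using b B_served Y_served by auto
    qed
    show "a \<notin> \<Theta> a \<and> (\<exists>t \<in> \<Theta> a. (a, t) \<in> F)" if a: "a \<in> A \<union> {}" for a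
    proof
      show "a \<notin> \<Theta> a" using a neq AB sub unfolding \<Theta>_def by auto
      show "\<exists>t \<in> \<Theta> a. (a, t) \<in> F" using a A_served by simp
    qed
    show "\<Theta> a \<subseteq> \<Theta> a' \<or> \<Theta> a' \<subseteq> \<Theta> a" for a a' unfolding \<Theta>_def by auto
    show "\<Sigma> b \<subseteq> \<Sigma> b' \<or> \<Sigma> b' \<subseteq> \<Sigma> b" for b b' using sub(3) unfolding \<Sigma>_def by auto
    show "b \<in> \<Theta> a \<or> a \<in> \<Sigma> b" if "a \<in> A \<union> {}" for a b using that unfolding \<Sigma>_def by auto
    fix E p q
    assume \<Theta>E: "\<And>a. a \<in> A \<union> {} \<Longrightarrow> \<exists>t \<in> \<Theta> a. (a, t) \<in> F \<and> (a, t) \<in> E"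
      and \<Sigma>E: "\<And>b. b \<in> B \<union> Y \<Longrightarrow> \<exists>s \<in> \<Sigma> b. (s, b) \<in> F \<and> (s, b) \<in> E"
      and uA: "\<And>a. a \<in> A \<union> {} \<Longrightarrow> (u, a) \<in> E" and Bu: "\<And>b. b \<in> B \<union> Y \<Longrightarrow> (b, u) \<in> E"
    assume "p \<in> insert u (N \<union> {} \<union> Y)" "q \<in> insert u (N \<union> {} \<union> Y)"
    then have pq: "p \<in> insert u (A \<union> B \<union> Y)" "q \<in> insert u (A \<union> B \<union> Y)" using AB by auto
    have to1: "joined E 1 b u" if "b \<in> B \<union> Y \<union> {u}" for b using Bu[of b] that joined_1[of b u E] by auto
    have to2: "joined E 2 a u" if a: "a \<in> Q \<union> A2" for a
    proof -
      have "a \<in> A" using a sub by auto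
      then obtain t where t: "t \<in> B \<union> Y \<union> {u}" "(a, t) \<in> E"
        using \<Theta>E[of a] a unfolding \<Theta>_def by (auto split: if_splits)
      show ?thesis by (rule joined_step[OF t(2) to1[OF t(1)]]) simp
    qed
    have to3: "joined E 3 a u" if a: "a \<in> A - A2 - Q" for a
    proof -
      obtain t where t: "t \<in> B \<union> Y \<union> {u} \<union> Q" "(a, t) \<in> E"
        using \<Theta>E[of a] a unfolding \<Theta>_def by auto
      then have "joined E 2 t u"
        using joined_mono[OF to1[of t], of 2] to2[of t] by auto
      from joined_step[OF t(2) this] show ?thesis by simp
    qed
    have to_cases: "joined E 2 p u \<or> p \<in> A - A2 - Q \<and> joined E 3 p u"
      using pq(1) joined_mono[OF to1[of p], of 2] to2[of p] to3[of p] by auto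
    have from1: "joined E 1 u a" if "a \<in> A \<union> {u}" for a using uA[of a] that joined_1[of u a E] by auto
    have from2: "joined E 2 u b" if b: "b \<in> B1 \<union> Yg" for b
    proof -
      have "b \<in> B \<union> Y" using b sub by auto
      then obtain s where s: "s \<in> A \<union> {u}" "(s, b) \<in> E"
        using \<Sigma>E[of b] b unfolding \<Sigma>_def by auto
      show ?thesis by (rule joined_step_right[OF from1[OF s(1)] s(2)]) simp
    qed
    have from2': "joined E 2 u b" if "b \<in> A \<union> {u} \<union> B1 \<union> Yg" for b
      using that joined_mono[OF from1[of b], of 2] from2[of b] by auto
    have from3: "joined E 3 u b" if b: "b \<in> B1 \<union> B2 \<union> Y" for b
    proof -
      have "b \<in> B \<union> Y" using b sub by auto
      then obtain s where s: "s \<in> A \<union> {u} \<union> B1 \<union> Yg" "(s, b) \<in> E"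
        using \<Sigma>E[of b] b unfolding \<Sigma>_def by (auto split: if_splits)
      from joined_step_right[OF from2'[OF s(1)] s(2)] show ?thesis by simp
    qed
    have via_Y: "\<exists>y \<in> Y - Yg. (y, b) \<in> E" if b: "b \<in> B - B1 - B2" for b
    proof -
      have "b \<notin> B1 \<union> Yg" "b \<notin> B2 \<union> Y" using b neq sub by auto
      then obtain s where s: "s \<in> A \<union> {u} \<union> B1 \<union> Y" "(s, b) \<in> F" "(s, b) \<in> E"
        using \<Sigma>E[of b] b unfolding \<Sigma>_def by (simp only: if_False) auto
      have "s \<notin> A \<union> {u}" using s(2) b unfolding B1_def by blast
      moreover have "s \<notin> B1 \<union> Yg" using s(2) b unfolding B2_def by blast
      ultimately show ?thesis using s by blast
    qed
    have from_cases: "joined E 3 u q \<or> q \<in> B - B1 - B2 \<and> joined E 4 u q"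
    proof (cases "q \<in> B - B1 - B2")
      case True
      then obtain y where y: "y \<in> Y - Yg" "(y, q) \<in> E" using via_Y by blast
      then have "joined E 3 u y" using from3 by simp
      from joined_step_right[OF this y(2), of 4] show ?thesis using True by simp
    next
      case False
      then show ?thesis using pq(2) joined_mono[OF from1[of q], of 3] from3[of q] by auto
    qed
    show "joined E 6 p q"
    proof (cases "p \<in> A - A2 - Q \<and> q \<in> B - B1 - B2")
      case False
      then consider "joined E 2 p u" "joined E 4 u q" | "joined E 3 p u" "joined E 3 u q"
        using to_cases from_cases joined_mono[of E 2 p u 3] joined_mono[of E 3 u q 4] by auto
      then show ?thesis
        by cases (use joined_trans_le in fastforce)+
    next
      case True
      \<comment> \<open>The walk runs from \<open>p\<close> to some \<open>t\<close> in
        \<open>Q\<close>, on to \<open>yg\<close>, to the other vertex \<open>z\<close> of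
        \<open>Y\<close>, and to \<open>q\<close>.\<close>
      then have p: "p \<in> A - Q" "p \<notin> A2" and q: "q \<in> B - B1 - B2" by auto
      obtain t where t: "t \<in> B \<union> Y \<union> {u} \<union> Q" "(p, t) \<in> F" "(p, t) \<in> E"
        using \<Theta>E[of p] p unfolding \<Theta>_def by (auto split: if_splits)
      have "t \<notin> B \<union> Y \<union> {u}" using t(2) p unfolding A2_def by blast
      then have tQ: "t \<in> Q" using t by blast
      then obtain y where y: "y \<in> Y" "(t, y) \<in> F" "(t, y) \<in> E"
        using \<Theta>E[of t] QA unfolding \<Theta>_def by auto
      then have "y \<in> Yg" using tQ QA unfolding Yg_def by blast
      obtain z where z: "z \<in> Y - Yg" "(z, q) \<in> E" using via_Y[OF q] by blast
      then have "y = yg" using Yg_unique[OF z(1)] y(1) \<open>y \<in> Yg\<close> by auto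
      have "\<Sigma> z = A \<union> {u} \<union> B1 \<union> Yg" using z(1) neq sub unfolding \<Sigma>_def by auto
      then obtain s where s: "s \<in> A \<union> {u} \<union> B1 \<union> Yg" "(s, z) \<in> F" "(s, z) \<in> E"
        using \<Sigma>E[of z] z(1) by blast
      have "s \<in> Y" using enter[OF s(2) z(1)] .
      then have "s = y" using s(2) no_loop Yg_unique[OF z(1)] \<open>y = yg\<close> by auto
      with s have yz: "(y, z) \<in> E" by simp
      have "joined E 1 z q" using joined_1[OF z(2)] .
      from joined_step[OF yz this, of 2] have "joined E 2 y q" by simp
      from joined_step[OF y(3) this, of 3] have "joined E 3 t q" by simp
      from joined_step[OF t(3) this, of 6] show ?thesis by simp
    qed
  qed (use AB in auto)
qed

text \<open>For this configuration a split can be written down: \<open>c\<close> and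
  \<open>d\<close> are 1 link from reaching \<open>u\<close>, \<open>x\<close> and \<open>b\<close>
  are 2, \<open>p\<close> and \<open>a\<close> are 3; starting from \<open>u\<close>, the vertices
  \<open>c\<close> and \<open>d\<close> take 2 links and the others 1. The sum is 3 + 2.\<close>

lemma routing_chain:
  assumes F: "(x, c) \<in> F" "(a, b) \<in> F" "(b, d) \<in> F" "(p, x) \<in> F"
    and distinct: "distinct [u, x, p, a, b, c, d]"
  shows "routing F u {p, a, b, d, c} {x} {} 5"
proof -
  define \<Theta> where "\<Theta> v = (if v \<in> {x, b} then {c, d, u} else {c, d, u, x, b})" for v
  show ?thesis
  proof (rule routingI[where A = "{p, a, b}" and B = "{d, c}" and \<Theta> = \<Theta> and \<Sigma> = "\<lambda>_. {p, a, b, x}"])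
    show "v \<notin> \<Theta> v \<and> (\<exists>t \<in> \<Theta> v. (v, t) \<in> F)" if "v \<in> {p, a, b} \<union> {x}" for v
      using that F distinct unfolding \<Theta>_def by auto
    show "\<Theta> v \<subseteq> \<Theta> v' \<or> \<Theta> v' \<subseteq> \<Theta> v" for v v' unfolding \<Theta>_def by auto
    fix E s t
    assume \<Theta>E: "\<And>v. v \<in> {p, a, b} \<union> {x} \<Longrightarrow> \<exists>t \<in> \<Theta> v. (v, t) \<in> F \<and> (v, t) \<in> E"
      and \<Sigma>E: "\<And>v. v \<in> {d, c} \<union> {} \<Longrightarrow> \<exists>s \<in> {p, a, b, x}. (s, v) \<in> F \<and> (s, v) \<in> E"
      and uA: "\<And>v. v \<in> {p, a, b} \<union> {x} \<Longrightarrow> (u, v) \<in> E"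
      and Bu: "\<And>v. v \<in> {d, c} \<union> {} \<Longrightarrow> (v, u) \<in> E"
      and st: "s \<in> insert u ({p, a, b, d, c} \<union> {x} \<union> {})" "t \<in> insert u ({p, a, b, d, c} \<union> {x} \<union> {})"
    have to1: "joined E 1 v u" if "v \<in> {c, d, u}" for v using Bu[of v] that joined_1[of v u E] by auto
    have to2: "joined E 2 v u" if v: "v \<in> {x, b}" for v
    proof -
      obtain t where t: "t \<in> {c, d, u}" "(v, t) \<in> E" using \<Theta>E[of v] v unfolding \<Theta>_def by auto
      show ?thesis by (rule joined_step[OF t(2) to1[OF t(1)]]) simp
    qed
    have to2': "joined E 2 v u" if "v \<in> {c, d, u, x, b}" for v
      using that to2[of v] joined_mono[OF to1[of v], of 2] by auto
    have to3: "joined E 3 s u"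
    proof (cases "s \<in> {c, d, u, x, b}")
      case True
      then show ?thesis using joined_mono[OF to2'] by simp
    next
      case False
      then have "s \<in> {p, a, b} \<union> {x}" "\<Theta> s = {c, d, u, x, b}" using st unfolding \<Theta>_def by auto
      then obtain t where t: "t \<in> {c, d, u, x, b}" "(s, t) \<in> E" using \<Theta>E[of s] by blast
      from joined_step[OF t(2) to2'[OF t(1)]] show ?thesis by simp
    qed
    have from1: "joined E 1 u v" if "v \<in> {p, a, b, x, u}" for v
      using uA[of v] that joined_1[of u v E] by auto
    have "joined E 2 u t"
    proof (cases "t \<in> {p, a, b, x, u}")
      case True
      then show ?thesis using joined_mono[OF from1] by simp
    next
      case False
      then have "t \<in> {d, c} \<union> {}" using st by auto
      then obtain v where v: "v \<in> {p, a, b, x}" "(v, t) \<in> E" using \<Sigma>E[of t] by blast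
      show ?thesis by (rule joined_step_right[OF from1 v(2)]) (use v(1) in auto)
    qed
    then show "joined E 5 s t" using joined_trans_le[OF to3] by simp
  qed (use F distinct in \<open>auto simp: \<Theta>_def\<close>)
qed

text \<open>
  The routing given by the split has length 5 unless the links contain two disjoint chains
  \<open>p \<rightarrow> x \<rightarrow> c\<close> and \<open>a \<rightarrow> b \<rightarrow> d\<close>. For \<open>card N = 5\<close> these chains exhaust \<open>N\<close>.
\<close>
lemma (in neighbourhood_links) routing_card_5:
  assumes X: "X = {x}" and Y: "Y = {}" and x_out: "\<exists>w. (x, w) \<in> F"
    and to_u: "\<And>v. (v, u) \<notin> F" and from_u: "\<And>v. v \<in> N \<Longrightarrow> (u, v) \<notin> F" and card: "card N = 5"
  shows "routing F u N {x} {} 5"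
proof (cases rule: split)
  case (1 A B)
  note AB = 1(1,2) and PB = 1(3) and min = 1(7)
  have "Q = {}" unfolding Q_def using Y by simp
  then have out: "\<exists>w \<in> B \<union> {x, u}. (a, w) \<in> F" if "a \<in> A" for a
    using 1(5)[OF that] X Y by auto
  have neq: "x \<noteq> u" "x \<notin> A" "x \<notin> B" "u \<notin> A" "u \<notin> B"
    using N_disj X_disj X AB by auto
  have V: "s \<in> insert u (A \<union> B \<union> {x})" "t \<in> insert u (A \<union> B \<union> {x})" if "(s, t) \<in> F" for s t
    using F_sub that X Y AB by auto
  have inP: "b \<in> P" if "(x, b) \<in> F" "b \<in> A \<union> B" for b
    using that X AB unfolding P_def by auto
  have Px: "(x, b) \<in> F" if "b \<in> P" for b using that X unfolding P_def by auto
  define B1 where "B1 = {b \<in> B - P. \<exists>s \<in> A. (s, b) \<in> F}"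
  define B2 where "B2 = {b \<in> B - P - B1. \<exists>s \<in> P. (s, b) \<in> F}"
  define A2 where "A2 = {a \<in> A. \<exists>w \<in> B. (a, w) \<in> F}"
  define \<Theta> where "\<Theta> a = (if a \<in> A2 \<union> {x} then B else B \<union> {x})" for a
  define \<Sigma> where "\<Sigma> b = (if b \<in> P then {x} else if b \<in> B1 then A \<union> {x}
    else if b \<in> B2 then A \<union> {x} \<union> P else A \<union> {x} \<union> P \<union> B1)" for b
  have B12: "B1 \<subseteq> B" "B2 \<subseteq> B" "B1 \<inter> P = {}" unfolding B1_def B2_def by auto
  obtain c where c: "c \<in> P" "(x, c) \<in> F"
  proof -
    obtain t where t: "(x, t) \<in> F" using x_out by blast
    moreover have "t \<noteq> x" "t \<noteq> u" using t no_loop to_u by auto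
    ultimately show thesis using V(2)[OF t] inP that by blast
  qed
  have A3: "(a, x) \<in> F" if "a \<in> A - A2" for a
    using out[of a] to_u that unfolding A2_def by blast
  have B3: "\<exists>s \<in> B1. (s, b) \<in> F" if b: "b \<in> B - P - B1 - B2" for b
  proof -
    obtain s where s: "(s, b) \<in> F" using 1(6) b by blast
    have "s \<notin> A" using s b unfolding B1_def by blast
    moreover have "s \<noteq> x" using s b inP by blast
    moreover have "s \<noteq> u" using s b AB from_u by blast
    ultimately have sB: "s \<in> B" using V(1)[OF s] by blast
    have "s \<notin> P" using s b unfolding B2_def by blast
    then have "s \<in> B1" using min[OF sB] s sB b unfolding B1_def by blast
    then show ?thesis using s by blast
  qed
  show ?thesis
  proof (cases "A - A2 = {} \<or> B - P - B1 - B2 = {}")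
    case False
    then obtain p d where p: "p \<in> A - A2" and d: "d \<in> B - P - B1 - B2" by blast
    obtain b where b: "b \<in> B1" "(b, d) \<in> F" using B3[OF d] by blast
    then obtain a where a: "a \<in> A" "(a, b) \<in> F" unfolding B1_def by blast
    have "a \<in> A2" using a b B12 unfolding A2_def by blast
    then have dist: "distinct [u, x, p, a, b, c, d]"
      using neq p d b a c AB PB B12 by auto
    then have "card {p, a, b, d, c} = 5" by auto
    moreover have "{p, a, b, d, c} \<subseteq> N" using p d b a c AB PB B12 by auto
    ultimately have "N = {p, a, b, d, c}" using card_subset_eq[OF fin] card by metis
    then show ?thesis
      using routing_chain[OF c(2) a(2) b(2) A3[OF p] dist] by simp
  next
    case True
    show ?thesis
    proof (rule routingI[where A = A and B = B and \<Theta> = \<Theta> and \<Sigma> = \<Sigma>])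
      show "b \<notin> \<Sigma> b \<and> (\<exists>s \<in> \<Sigma> b. (s, b) \<in> F)" if b: "b \<in> B \<union> {}" for b
      proof
        show "b \<notin> \<Sigma> b" using b neq AB PB B12 unfolding \<Sigma>_def by auto
        consider "b \<in> P" | "b \<in> B1" "b \<notin> P" | "b \<in> B2" "b \<notin> P" "b \<notin> B1"
          | "b \<in> B - P - B1 - B2" using b by blast
        then show "\<exists>s \<in> \<Sigma> b. (s, b) \<in> F"
        proof cases
          case 1
          then show ?thesis using Px unfolding \<Sigma>_def by simp
        next
          case 2
          then show ?thesis unfolding \<Sigma>_def B1_def by auto
        next
          case 3
          then have "\<exists>s \<in> P. (s, b) \<in> F" unfolding B2_def by blast
          then show ?thesis using 3 unfolding \<Sigma>_def by auto
        next
          case 4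
          then show ?thesis using B3[OF 4] unfolding \<Sigma>_def by auto
        qed
      qed
      show "a \<notin> \<Theta> a \<and> (\<exists>t \<in> \<Theta> a. (a, t) \<in> F)" if a: "a \<in> A \<union> {x}" for a
      proof
        show "a \<notin> \<Theta> a" using a neq AB unfolding \<Theta>_def by auto
        consider "a = x" | "a \<in> A2" | "a \<in> A - A2" using a by blast
        then show "\<exists>t \<in> \<Theta> a. (a, t) \<in> F"
        proof cases
          case 1
          then show ?thesis using c PB unfolding \<Theta>_def by auto
        next
          case 2
          then show ?thesis unfolding \<Theta>_def A2_def by auto
        next
          case 3
          then show ?thesis using A3[OF 3] neq unfolding \<Theta>_def by auto
        qed
      qed
      show "\<Theta> a \<subseteq> \<Theta> a' \<or> \<Theta> a' \<subseteq> \<Theta> a" for a a' unfolding \<Theta>_def by auto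
      show "\<Sigma> b \<subseteq> \<Sigma> b' \<or> \<Sigma> b' \<subseteq> \<Sigma> b" for b b' unfolding \<Sigma>_def by auto
      show "b \<in> \<Theta> a \<or> a \<in> \<Sigma> b" if "b \<in> B \<union> {}" for a b using that unfolding \<Theta>_def by auto
      fix E p q
      assume \<Theta>E: "\<And>a. a \<in> A \<union> {x} \<Longrightarrow> \<exists>t \<in> \<Theta> a. (a, t) \<in> F \<and> (a, t) \<in> E"
        and \<Sigma>E: "\<And>b. b \<in> B \<union> {} \<Longrightarrow> \<exists>s \<in> \<Sigma> b. (s, b) \<in> F \<and> (s, b) \<in> E"
        and uA: "\<And>a. a \<in> A \<union> {x} \<Longrightarrow> (u, a) \<in> E" and Bu: "\<And>b. b \<in> B \<union> {} \<Longrightarrow> (b, u) \<in> E"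
      assume "p \<in> insert u (N \<union> {x} \<union> {})" "q \<in> insert u (N \<union> {x} \<union> {})"
      then have pq: "p \<in> insert u (A \<union> B \<union> {x})" "q \<in> insert u (A \<union> B \<union> {x})" using AB by auto
      have to1: "joined E 1 b u" if "b \<in> B \<union> {u}" for b using Bu[of b] that joined_1[of b u E] by auto
      have to2: "joined E 2 a u" if a: "a \<in> A2 \<union> {x}" for a
      proof -
        have "a \<in> A \<union> {x}" "\<Theta> a = B" using a unfolding A2_def \<Theta>_def by auto
        then obtain t where t: "t \<in> B \<union> {u}" "(a, t) \<in> E" using \<Theta>E[of a] by blast
        show ?thesis by (rule joined_step[OF t(2) to1[OF t(1)]]) simp
      qed
      have A3E: "t \<in> B \<Longrightarrow> (a, t) \<notin> F" "(a, x) \<in> E" if a: "a \<in> A - A2" for a t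
      proof -
        show no: "(a, t) \<notin> F" if "t \<in> B" for t using a that unfolding A2_def by blast
        have "\<Theta> a = B \<union> {x}" using a neq unfolding \<Theta>_def by auto
        then show "(a, x) \<in> E" using \<Theta>E[of a] a no by auto
      qed
      have to3: "joined E 3 a u" if a: "a \<in> A - A2" for a
        using joined_step[OF A3E(2)[OF a] to2] by simp
      have to_cases: "joined E 2 p u \<or> p \<in> A - A2 \<and> joined E 3 p u"
        using pq(1) joined_mono[OF to1[of p], of 2] to2[of p] to3[of p] by auto
      have from1: "joined E 1 u a" if "a \<in> A \<union> {x, u}" for a using uA[of a] that joined_1[of u a E] by auto
      have from2: "joined E 2 u b" if b: "b \<in> P \<union> B1" for b
      proof -
        have "b \<in> B" "\<Sigma> b \<subseteq> A \<union> {x}" using b PB B12 unfolding \<Sigma>_def by auto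
        then obtain s where s: "s \<in> A \<union> {x, u}" "(s, b) \<in> E" using \<Sigma>E[of b] by blast
        show ?thesis by (rule joined_step_right[OF from1[OF s(1)] s(2)]) simp
      qed
      have from3: "joined E 3 u b" if b: "b \<in> B" for b
      proof -
        have "\<Sigma> b \<subseteq> A \<union> {x} \<union> P \<union> B1" unfolding \<Sigma>_def by auto
        then obtain s where s: "s \<in> A \<union> {x} \<union> P \<union> B1" "(s, b) \<in> E" using \<Sigma>E[of b] b by blast
        then have "joined E 2 u s" using joined_mono[OF from1[of s], of 2] from2[of s] by auto
        from joined_step_right[OF this s(2)] show ?thesis by simp
      qed
      have from_cases: "joined E 2 u q \<or> q \<in> B - P - B1 \<and> joined E 3 u q"
        using pq(2) joined_mono[OF from1[of q], of 2] from2[of q] from3[of q] by auto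
      show "joined E 5 p q"
      proof (cases "p \<in> A - A2 \<and> q \<in> B - P - B1")
        case False
        then consider "joined E 2 p u" "joined E 3 u q" | "joined E 3 p u" "joined E 2 u q"
          using to_cases from_cases joined_mono[of E 2 p u 3] joined_mono[of E 2 u q 3] by auto
        then show ?thesis
          by cases (use joined_trans_le in fastforce)+
      next
        case pq3: True
        \<comment> \<open>The sum 3 + 3 is bypassed: \<open>p\<close> keeps a link to
          \<open>x\<close>, and \<open>q\<close> is entered from some \<open>s\<close> in
          \<open>P\<close>, which is entered from \<open>x\<close>, so three links suffice.\<close>
        then have q: "q \<in> B2" using True by blast
        then have "\<Sigma> q = A \<union> {x} \<union> P" using pq3 unfolding \<Sigma>_def by auto
        then obtain s where s: "s \<in> A \<union> {x} \<union> P" "(s, q) \<in> F" "(s, q) \<in> E"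
          using \<Sigma>E[of q] pq3 by blast
        have "s \<notin> A" using s(2) pq3 unfolding B1_def by blast
        moreover have "s \<noteq> x" using s(2) pq3 inP by blast
        ultimately have sP: "s \<in> P" using s(1) by blast
        then have "\<Sigma> s = {x}" unfolding \<Sigma>_def by simp
        then have xs: "(x, s) \<in> E" using \<Sigma>E[of s] sP PB by auto
        have px: "(p, x) \<in> E" using A3E(2) pq3 by blast
        from joined_step[OF xs joined_1[OF s(3)], of 2] have "joined E 2 x q" by simp
        from joined_step[OF px this, of 5] show ?thesis by simp
      qed
    qed (use AB in auto)
  qed
qed

lemma neighbourhood_links_converse:
  assumes "neighbourhood_links F u N X Y"
  shows "neighbourhood_links (F\<inverse>) u N Y X"
proof -
  interpret neighbourhood_links F u N X Y by (fact assms)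
  show ?thesis
  proof
    show "F\<inverse> \<subseteq> insert u (N \<union> Y \<union> X) \<times> insert u (N \<union> Y \<union> X)" using F_sub by auto
    show "\<exists>w. (v, w) \<in> F\<inverse> \<or> (w, v) \<in> F\<inverse>" if "v \<in> N" for v using N_linked[OF that] by auto
  qed (use fin no_loop N_disj X_disj in auto)
qed

section \<open>The oriented diameter\<close>

lemma (in wf_digraph) ex_awalk_if_relpow:
  assumes "(x, y) \<in> arcs_ends G ^^ j" "x \<in> verts G"
  shows "\<exists>p. awalk x p y \<and> length p = j"
  using assms
proof (induction j arbitrary: x)
  case 0
  then show ?case by (intro exI[of _ "[]"]) (simp add: awalk_Nil_iff)
next
  case (Suc j)
  then obtain z where z: "(x, z) \<in> arcs_ends G" "(z, y) \<in> arcs_ends G ^^ j"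
    using relpow_Suc_D2 by metis
  then obtain e where e: "e \<in> arcs G" "tail G e = x" "head G e = z"
    by (auto simp: arcs_ends_conv)
  then have "z \<in> verts G" using wellformed by blast
  then obtain p where "awalk z p y" "length p = j" using Suc.IH z(2) by blast
  then show ?case
    using e Suc.prems(2) by (intro exI[of _ "e # p"]) (simp add: awalk_Cons_iff)
qed

text \<open>Distances are defined by paths but estimated by walks; cutting out cycles only shortens
  a walk.\<close>

lemma (in wf_digraph) length_awalk_to_apath:
  assumes "awalk u p v"
  shows "length (awalk_to_apath p) \<le> length p"
  using assms
proof (induct rule: awalk_to_apath_induct)
  case (path p)
  then have "awalk_to_apath p = p" by (auto simp: awalk_to_apath.simps)
  then show ?case by simp
next
  case (decomp p q r s)
  then have "length (q @ s) \<le> length p" by (auto elim!: awalk_cyc_decompE)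
  then show ?case using decomp step_awalk_to_apath[of u p v q r s] by simp
qed

lemma distance_le:
  assumes "parcs D \<subseteq> pverts D \<times> pverts D" "x \<in> pverts D" "joined (parcs D) k x y"
  shows "distance D x y \<le> enat k"
proof -
  interpret wf_digraph "with_proj D" using assms(1) by unfold_locales auto
  obtain j where "j \<le> k" "(x, y) \<in> parcs D ^^ j" using assms(3) unfolding joined_def by blast
  then obtain p where p: "awalk x p y" "length p \<le> k"
    using ex_awalk_if_relpow[of x y j] assms(2) by auto
  have "distance D x y \<le> enat (length (awalk_to_apath p))"
    unfolding distance_def by (rule INF_lower) (use apath_awalk_to_apath[OF p(1)] in simp)
  also have "\<dots> \<le> enat k" using length_awalk_to_apath[OF p(1)] p(2) by simp
  finally show ?thesis .
qed

lemma oriented_diameter_le_if_joined: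
  assumes "orientation G D" "mverts G \<noteq> {}" "parcs D \<subseteq> mverts G \<times> mverts G"
    and joined: "\<And>x y. x \<in> mverts G \<Longrightarrow> y \<in> mverts G \<Longrightarrow> joined (parcs D) k x y"
  shows "oriented_diameter G \<le> enat k"
proof -
  have V: "pverts D = mverts G" using assms(1) unfolding orientation_def by auto
  interpret wf_digraph "with_proj D" using assms(3) V by unfold_locales auto
  have "strongly_connected (with_proj D)"
  proof
    show "verts (with_proj D) \<noteq> {}" using assms(2) V by simp
    fix x y assume xy: "x \<in> verts (with_proj D)" "y \<in> verts (with_proj D)"
    then have "joined (parcs D) k x y" using joined V by simp
    then obtain j where "(x, y) \<in> parcs D ^^ j" unfolding joined_def by blast
    then show "x \<rightarrow>\<^sup>*\<^bsub>with_proj D\<^esub> y"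
      using ex_awalk_if_relpow[of x y j] xy reachable_awalkI by auto
  qed
  then have "oriented_diameter G \<le> diameter D"
    unfolding oriented_diameter_def strong_orientation_def
    using assms(1) by (intro INF_lower) simp
  also have "\<dots> \<le> enat k"
    unfolding diameter_def
    using distance_le[of D] assms(3) V joined by (intro SUP_least) auto
  finally show ?thesis .
qed

section \<open>Neighbours, links and strong orientations of a mixed graph\<close>

definition (in mixed_graph) undirected_neighbours :: "'a \<Rightarrow> 'a set" where
  "undirected_neighbours u = {v. {u, v} \<in> uedges G}"

definition (in mixed_graph) out_neighbours :: "'a \<Rightarrow> 'a set" where
  "out_neighbours u = {v. (u, v) \<in> darcs G}"

definition (in mixed_graph) in_neighbours :: "'a \<Rightarrow> 'a set" where
  "in_neighbours u = {v. (v, u) \<in> darcs G}"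

lemma (in mixed_graph) edge_ends:
  assumes "{x, y} \<in> uedges G"
  shows "x \<in> mverts G" "y \<in> mverts G" "x \<noteq> y"
  using uedges_wf[OF assms] by auto

lemma (in mixed_graph) neighbours_subset:
  "undirected_neighbours u \<subseteq> mverts G" "out_neighbours u \<subseteq> mverts G" "in_neighbours u \<subseteq> mverts G"
  unfolding undirected_neighbours_def out_neighbours_def in_neighbours_def
  using edge_ends darcs_wf by auto

lemma (in mixed_graph) finite_neighbours:
  "finite (undirected_neighbours u)" "finite (out_neighbours u)" "finite (in_neighbours u)"
  using neighbours_subset finite_mverts finite_subset by metis+

lemma (in mixed_graph) neighbours_disjoint:
  "undirected_neighbours u \<inter> out_neighbours u = {}" "undirected_neighbours u \<inter> in_neighbours u = {}"
  "out_neighbours u \<inter> in_neighbours u = {}"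
  "u \<notin> undirected_neighbours u" "u \<notin> out_neighbours u" "u \<notin> in_neighbours u"
  unfolding undirected_neighbours_def out_neighbours_def in_neighbours_def
  unfolding disjoint_iff mem_Collect_eq
  by (metis edge_ends(3) darcs_wf darcs_antiparallel darcs_uedges insert_commute)+

lemma (in mixed_graph) card_undirected_neighbours: "card (undirected_neighbours u) = undirected_degree G u"
proof -
  have "{e \<in> uedges G. u \<in> e} = (\<lambda>v. {u, v}) ` undirected_neighbours u"
  proof
    show "{e \<in> uedges G. u \<in> e} \<subseteq> (\<lambda>v. {u, v}) ` undirected_neighbours u"
    proof
      fix e assume e: "e \<in> {e \<in> uedges G. u \<in> e}"
      then obtain a b where "e = {a, b}" using uedges_wf[of e] by (auto simp: card_2_iff)
      then show "e \<in> (\<lambda>v. {u, v}) ` undirected_neighbours u"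
        using e unfolding undirected_neighbours_def by (auto simp: insert_commute)
    qed
  qed (auto simp: undirected_neighbours_def)
  moreover have "inj_on (\<lambda>v. {u, v}) (undirected_neighbours u)"
    by (auto simp: inj_on_def doubleton_eq_iff)
  ultimately show ?thesis unfolding undirected_degree_def by (simp add: card_image)
qed

lemma (in mixed_graph) card_out_neighbours: "card (out_neighbours u) = directed_out_degree G u"
proof -
  have "{a \<in> darcs G. fst a = u} = Pair u ` out_neighbours u"
    unfolding out_neighbours_def by auto
  then show ?thesis unfolding directed_out_degree_def by (simp add: card_image inj_on_def)
qed

lemma (in mixed_graph) card_in_neighbours: "card (in_neighbours u) = directed_in_degree G u"
proof -
  have "{a \<in> darcs G. snd a = u} = (\<lambda>v. (v, u)) ` in_neighbours u"
    unfolding in_neighbours_def by auto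
  then show ?thesis unfolding directed_in_degree_def by (simp add: card_image inj_on_def)
qed

lemma (in mixed_graph) steps_strong:
  assumes "mixed_connected G" "x \<in> mverts G" "y \<in> mverts G"
  shows "(x, y) \<in> (steps (darcs G) (uedges G))\<^sup>*"
proof -
  obtain p where p: "orientable_path G x p y" using assms unfolding mixed_connected_def by blast
  have "(p ! 0, p ! i) \<in> (steps (darcs G) (uedges G))\<^sup>*" if "i < length p" for i
    using that
  proof (induction i)
    case (Suc i)
    then have "(p ! i, p ! Suc i) \<in> steps (darcs G) (uedges G)"
      using p unfolding orientable_path_def in_steps_iff by blast
    with Suc show ?case by (meson Suc_lessD rtrancl_into_rtrancl)
  qed simp
  from this[of "length p - 1"] have "p \<noteq> [] \<Longrightarrow> (hd p, last p) \<in> (steps (darcs G) (uedges G))\<^sup>*"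
    by (simp add: hd_conv_nth last_conv_nth)
  then show ?thesis using p unfolding orientable_path_def by blast
qed

lemma (in mixed_graph) steps_bridgeless:
  assumes "bridgeless G" "{x, y} \<in> uedges G"
  shows "(x, y) \<in> (steps (darcs G \<union> (darcs G)\<inverse>) (uedges G - {{x, y}}))\<^sup>*"
proof -
  let ?H = "G\<lparr>uedges := uedges G - {{x, y}}\<rparr>"
  have "connected (with_proj (underlying_graph ?H))"
    using assms unfolding bridgeless_def bridge_def by blast
  then have "x \<rightarrow>\<^sup>*\<^bsub>with_proj (mk_symmetric (with_proj (underlying_graph ?H)))\<^esub> y"
    using edge_ends[OF assms(2)]
    unfolding connected_def strongly_connected_def by (simp add: underlying_graph_def)
  then have "(x, y) \<in> (parcs (mk_symmetric (with_proj (underlying_graph ?H))))\<^sup>*"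
    unfolding reachable_def by (simp add: rtrancl_on_rtranclI)
  then show ?thesis
  proof (rule rtrancl_replace)
    fix a b assume "(a, b) \<in> parcs (mk_symmetric (with_proj (underlying_graph ?H)))"
    then have "(a, b) \<in> parcs (underlying_graph ?H) \<or> (b, a) \<in> parcs (underlying_graph ?H)"
      by (auto simp: parcs_mk_symmetric)
    then have "(a, b) \<in> steps (darcs G \<union> (darcs G)\<inverse>) (uedges G - {{x, y}})"
      unfolding underlying_graph_def in_steps_iff by (auto simp: insert_commute)
    then show "(a, b) \<in> (steps (darcs G \<union> (darcs G)\<inverse>) (uedges G - {{x, y}}))\<^sup>*" by simp
  qed
qed

text \<open>The undirected edges at \<open>u\<close> are left out because the split into
  \<open>A\<close> and \<open>B\<close> will direct them; directed edges at \<open>u\<close>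
  remain.\<close>

definition (in mixed_graph) free_steps :: "'a \<Rightarrow> 'a rel" where
  "free_steps u = {(x, y) \<in> steps (darcs G) (uedges G). {x, y} \<in> uedges G \<longrightarrow> u \<notin> {x, y}}"

lemma (in mixed_graph) in_free_steps_iff:
  "(x, y) \<in> free_steps u \<longleftrightarrow> (x, y) \<in> darcs G \<or> {x, y} \<in> uedges G \<and> u \<noteq> x \<and> u \<noteq> y"
  unfolding free_steps_def using darcs_uedges by (auto simp: in_steps_iff)

lemma (in mixed_graph) steps_subset:
  assumes "U \<subseteq> uedges G"
  shows "steps (darcs G) U \<subseteq> mverts G \<times> mverts G"
proof (rule subrelI)
  fix x y assume "(x, y) \<in> steps (darcs G) U"
  then consider "(x, y) \<in> darcs G" | "{x, y} \<in> uedges G" using assms by (auto simp: in_steps_iff)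
  then show "(x, y) \<in> mverts G \<times> mverts G" by cases (use darcs_wf edge_ends in auto)
qed

text \<open>An undirected edge at \<open>u\<close> joins two vertices of \<open>T - S\<close>, so no
  arc starting in \<open>S\<close> or outside \<open>T\<close> uses one. \<open>link_leaving\<close>
  therefore applies to a walk from \<open>S\<close> to \<open>u\<close>, and to a reversed walk from
  \<open>u\<close> to \<open>S\<close>.\<close>

lemma (in mixed_graph) leaving_free_steps:
  assumes con: "mixed_connected G" and u: "u \<in> mverts G"
    and T: "insert u (undirected_neighbours u) \<subseteq> T"
    and S: "S \<subseteq> T - {u} - undirected_neighbours u" "S \<subseteq> mverts G" "S \<noteq> {}"
  shows "\<exists>s \<in> S. \<exists>t \<in> T - S. (s, t) \<in> links T (free_steps u)"
    and "\<exists>s \<in> S. \<exists>t \<in> T - S. (t, s) \<in> links T (free_steps u)"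
proof -
  let ?E = "steps (darcs G) (uedges G)"
  obtain s where s: "s \<in> S" using S by blast
  have free: "(v, w) \<in> free_steps u" if "(v, w) \<in> ?E" "v \<in> S \<or> v \<notin> T" for v w
  proof -
    have "v \<noteq> u" "v \<notin> undirected_neighbours u" using that(2) S T by auto
    then show ?thesis
      using that(1) by (auto simp: in_free_steps_iff in_steps_iff undirected_neighbours_def insert_commute)
  qed
  have free': "(v, w) \<in> (free_steps u)\<inverse>" if "(v, w) \<in> ?E\<inverse>" "v \<in> S \<or> v \<notin> T" for v w
  proof -
    have "v \<noteq> u" "v \<notin> undirected_neighbours u" using that(2) S T by auto
    then show ?thesis
      using that(1) by (auto simp: in_free_steps_iff in_steps_iff undirected_neighbours_def insert_commute)
  qed
  have uT: "u \<in> T - S" and ST: "S \<subseteq> T" using T S by auto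
  have "(s, u) \<in> ?E\<^sup>*" using steps_strong[OF con] s S u by blast
  from link_leaving[OF this s uT ST, of "free_steps u"] free
  show "\<exists>s \<in> S. \<exists>t \<in> T - S. (s, t) \<in> links T (free_steps u)" by blast
  have "(u, s) \<in> ?E\<^sup>*" using steps_strong[OF con] s S u by blast
  then have "(s, u) \<in> (?E\<inverse>)\<^sup>*" by (rule rtrancl_converseI)
  from link_leaving[OF this s uT ST, of "(free_steps u)\<inverse>"] free'
  show "\<exists>s \<in> S. \<exists>t \<in> T - S. (t, s) \<in> links T (free_steps u)" by (simp add: links_converse)
qed

text \<open>Even without the edge \<open>{u, v}\<close>, one of \<open>u\<close> and
  \<open>v\<close> reaches the other. Along such a walk, read from \<open>v\<close>, an arc starting
  at \<open>v\<close> or outside \<open>T\<close> uses no undirected edge at \<open>u\<close>, and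
  \<open>link_leaving\<close> with \<open>S = {v}\<close> yields the link.\<close>

lemma (in mixed_graph) nonbridge_linked:
  assumes bl: "bridgeless G" and v: "v \<in> undirected_neighbours u"
    and T: "insert u (undirected_neighbours u) \<subseteq> T"
  shows "\<exists>w. (v, w) \<in> links T (free_steps u) \<or> (w, v) \<in> links T (free_steps u)"
proof -
  let ?U = "uedges G - {{u, v}}"
  let ?E = "steps (darcs G) ?U"
  have uv: "{u, v} \<in> uedges G" using v unfolding undirected_neighbours_def by simp
  note V = edge_ends[OF uv]
  have con: "mixed_connected G" using bl unfolding bridgeless_def by simp
  have "(u, v) \<in> ?E\<^sup>* \<or> (v, u) \<in> ?E\<^sup>*"
  proof (rule nonbridge_orientable[where V = "mverts G"])
    have "steps (darcs G) (uedges G) \<subseteq> ?E \<union> {(u, v), (v, u)}"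
      by (auto simp: in_steps_iff doubleton_eq_iff)
    then show "(a, b) \<in> (?E \<union> {(u, v), (v, u)})\<^sup>*" if "a \<in> mverts G" "b \<in> mverts G" for a b
      using steps_strong[OF con that] rtrancl_mono by blast
    have "steps (darcs G \<union> (darcs G)\<inverse>) ?U \<subseteq> ?E \<union> ?E\<inverse>"
      by (auto simp: in_steps_iff)
    then show "(u, v) \<in> (?E \<union> ?E\<inverse>)\<^sup>*" using steps_bridgeless[OF bl uv] rtrancl_mono by blast
  qed (use V steps_subset in auto)
  then have "(v, u) \<in> (?E\<inverse>)\<^sup>* \<or> (v, u) \<in> ?E\<^sup>*" by (simp only: rtrancl_converse converse_iff)
  moreover have free: "{a, b} \<in> uedges G \<and> u \<noteq> a \<and> u \<noteq> b" if "{a, b} \<in> ?U" "a \<in> {v} \<or> a \<notin> T" for a b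
  proof -
    have "a \<noteq> u" "a = v \<or> a \<notin> undirected_neighbours u" using that(2) T V by auto
    then show ?thesis using that(1) by (auto simp: undirected_neighbours_def insert_commute)
  qed
  have vT: "v \<in> {v}" "u \<in> T - {v}" "{v} \<subseteq> T" using T V v by auto
  have 1: "(a, b) \<in> free_steps u" if "(a, b) \<in> ?E" "a \<in> {v} \<or> a \<notin> T" for a b
    using that free[of a b] by (auto simp: in_steps_iff in_free_steps_iff)
  have 2: "(a, b) \<in> (free_steps u)\<inverse>" if "(a, b) \<in> ?E\<inverse>" "a \<in> {v} \<or> a \<notin> T" for a b
  proof -
    have "(b, a) \<in> darcs G \<or> {a, b} \<in> ?U" using that(1) by (auto simp: in_steps_iff insert_commute)
    then show ?thesis
      using free[of a b] that(2) by (auto simp: in_free_steps_iff insert_commute[of b a])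
  qed
  ultimately show ?thesis
  proof (elim disjE)
    assume "(v, u) \<in> (?E\<inverse>)\<^sup>*"
    from link_leaving[OF this vT 2] show ?thesis by (auto simp: links_converse)
  next
    assume "(v, u) \<in> ?E\<^sup>*"
    from link_leaving[OF this vT 1] show ?thesis by auto
  qed
qed

lemma (in mixed_graph) neighbourhood_links_free_steps:
  assumes bl: "bridgeless G" and X: "X \<subseteq> out_neighbours u" and Y: "Y \<subseteq> in_neighbours u"
  shows "neighbourhood_links (links (insert u (undirected_neighbours u \<union> X \<union> Y)) (free_steps u))
    u (undirected_neighbours u) X Y"
proof
  fix v assume v: "v \<in> undirected_neighbours u"
  show "\<exists>w. (v, w) \<in> links (insert u (undirected_neighbours u \<union> X \<union> Y)) (free_steps u) \<or>
    (w, v) \<in> links (insert u (undirected_neighbours u \<union> X \<union> Y)) (free_steps u)"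
    by (rule nonbridge_linked[OF bl v]) blast
next
  show "links (insert u (undirected_neighbours u \<union> X \<union> Y)) (free_steps u) \<subseteq>
    insert u (undirected_neighbours u \<union> X \<union> Y) \<times> insert u (undirected_neighbours u \<union> X \<union> Y)"
    by (rule links_subset)
  show "finite (undirected_neighbours u)" by (rule finite_neighbours)
  show "undirected_neighbours u \<inter> X = {}" "undirected_neighbours u \<inter> Y = {}" "u \<notin> undirected_neighbours u"
    "X \<inter> Y = {}" "u \<notin> X" "u \<notin> Y"
    using neighbours_disjoint[of u] X Y by blast+
  show "(v, v) \<notin> links (insert u (undirected_neighbours u \<union> X \<union> Y)) (free_steps u)" for v
    by (simp add: in_links_iff)
qed

lemma (in mixed_graph) oriented_diameter_le_if_routing:
  assumes bl: "bridgeless G" and u: "u \<in> mverts G"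
    and X: "X \<subseteq> out_neighbours u" and Y: "Y \<subseteq> in_neighbours u"
    and T: "T = insert u (undirected_neighbours u \<union> X \<union> Y)"
    and routing: "routing (links T (free_steps u)) u (undirected_neighbours u) X Y k"
  shows "oriented_diameter G \<le> enat (card (mverts G) - card T + k)"
  using routing
proof (cases rule: routingE)
  case (1 A B \<R>)
  note AB = 1(1,2) and joins = 1(5)
  have con: "mixed_connected G" using bl unfolding bridgeless_def by simp
  have TV: "T \<subseteq> mverts G" using T u neighbours_subset X Y by blast
  have "free_steps u \<subseteq> mverts G \<times> mverts G"
    using steps_subset[OF order_refl] unfolding free_steps_def by blast
  then have fin: "finite (free_steps u)" using finite_mverts finite_subset by blast
  show ?thesis
  proof (rule uncross[where T = T, OF fin 1(3)])
    show "\<rho> \<inter> links T (free_steps u) \<noteq> {}" if "\<rho> \<in> \<R>" for \<rho> using 1(4) that .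
  next
    fix R
    assume R: "R \<subseteq> free_steps u" "\<And>\<rho>. \<rho> \<in> \<R> \<Longrightarrow> \<rho> \<inter> links T R \<noteq> {}" "R \<inter> R\<inverse> = {}"
      and R_ends: "\<And>x y. (x, y) \<in> R \<Longrightarrow> \<exists>s \<in> T. \<exists>t \<in> T. (s, x) \<in> R\<^sup>* \<and> (y, t) \<in> R\<^sup>*"
  define W where "W = R \<union> {u} \<times> (A \<union> X) \<union> (B \<union> Y) \<times> {u}"
  have nb: "A \<union> X \<subseteq> T - {u}" "B \<union> Y \<subseteq> T - {u}" "u \<in> T"
    using T AB X Y neighbours_disjoint[of u] by auto
  have edges: "(u, a) \<in> darcs G \<or> {u, a} \<in> uedges G" if "a \<in> A \<union> X" for a
    using that AB X unfolding undirected_neighbours_def out_neighbours_def by blast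
  have edges': "(b, u) \<in> darcs G \<or> {b, u} \<in> uedges G" if "b \<in> B \<union> Y" for b
    using that AB Y unfolding undirected_neighbours_def in_neighbours_def by (auto simp: insert_commute)
  have W_steps: "(x, y) \<in> darcs G \<or> {x, y} \<in> uedges G" if "(x, y) \<in> W" for x y
    using that R(1) edges edges' unfolding W_def by (auto simp: in_free_steps_iff)
  \<comment> \<open>Edges away from \<open>u\<close> are used one way since \<open>R\<close> and its
    converse are disjoint; edges at \<open>u\<close> do not occur in \<open>R\<close> and belong to
    only one of \<open>A\<close> and \<open>B\<close>.\<close>
  have W_anti: "(y, x) \<notin> W" if xy: "(x, y) \<in> W" "{x, y} \<in> uedges G" for x y
  proof
    assume yx: "(y, x) \<in> W"
    show False
    proof (cases "u \<in> {x, y}")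
      case False
      then show False using xy yx R(3) unfolding W_def by auto
    next
      case True
      have nf: "(a, b) \<notin> R" if "{a, b} = {x, y}" for a b
      proof
        assume "(a, b) \<in> R"
        then have "(a, b) \<in> darcs G \<or> u \<notin> {a, b}" using R(1) by (auto simp: in_free_steps_iff)
        then show False using darcs_uedges[of a b] that True xy(2) by auto
      qed
      have "A \<inter> B = {}" "A \<inter> Y = {}" "X \<inter> B = {}" "X \<inter> Y = {}"
        using AB X Y neighbours_disjoint[of u] by auto
      then show False
        using xy yx nf[of x y] nf[of y x] True nb unfolding W_def by auto
    qed
  qed
  have link_W: "links T R \<union> {u} \<times> (A \<union> X) \<union> (B \<union> Y) \<times> {u} \<subseteq> links T W"
  proof -
    have "links T R \<subseteq> links T W" unfolding W_def by (rule links_mono) blast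
    moreover have "{u} \<times> (A \<union> X) \<subseteq> links T W"
    proof
      fix p assume p: "p \<in> {u} \<times> (A \<union> X)"
      then have "snd p \<in> T - {u}" using nb(1) by auto
      moreover have "p \<in> W" using p unfolding W_def by blast
      ultimately show "p \<in> links T W"
        using p nb(3) link_arc[of u "snd p" W T] by (cases p) (auto simp: in_links_iff)
    qed
    moreover have "(B \<union> Y) \<times> {u} \<subseteq> links T W"
    proof
      fix p assume p: "p \<in> (B \<union> Y) \<times> {u}"
      then have "fst p \<in> T - {u}" using nb(2) by auto
      moreover have "p \<in> W" using p unfolding W_def by blast
      ultimately show "p \<in> links T W"
        using p nb(3) link_arc[of "fst p" u W T] by (cases p) (auto simp: in_links_iff)
    qed
    ultimately show ?thesis by blast
  qed
  have N: "insert u (undirected_neighbours u \<union> X \<union> Y) = T" using T by simp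
  have joined_W: "joined (links T W) k p q" if "p \<in> T" "q \<in> T" for p q
  proof (rule joined_mono_rel[OF link_W])
    have "R \<subseteq> free_steps u" by (fact R(1))
    then have "links T R \<subseteq> links T (free_steps u)" by (rule links_mono)
    then show "joined (links T R \<union> {u} \<times> (A \<union> X) \<union> (B \<union> Y) \<times> {u}) k p q"
      using joins[OF _ R(2)] that N by blast
  qed
  have T_strong: "(p, q) \<in> W\<^sup>*" if "p \<in> T" "q \<in> T" for p q
  proof (rule rtrancl_replace)
    show "(p, q) \<in> (links T W)\<^sup>*" using joined_W[OF that] by (rule joined_imp_rtrancl)
    show "(a, b) \<in> W\<^sup>*" if "(a, b) \<in> links T W" for a b
      using that link_imp_rtrancl by (auto simp: in_links_iff)
  qed
  \<comment> \<open>Each arc of \<open>W\<close> lies on a closed walk in \<open>W\<close>, so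
    fixing its direction loses no reachability: a step against the arc is replaced by the rest of
    the closed walk.\<close>
  have W_back: "(y, x) \<in> W\<^sup>*" if xy: "(x, y) \<in> W" for x y
  proof -
    have "\<exists>s \<in> T. \<exists>t \<in> T. (s, x) \<in> W\<^sup>* \<and> (y, t) \<in> W\<^sup>*"
    proof (cases "(x, y) \<in> R")
      case True
      have "R\<^sup>* \<subseteq> W\<^sup>*" unfolding W_def by (rule rtrancl_mono) blast
      then show ?thesis using R_ends[OF True] by blast
    next
      case False
      then have "x \<in> T" "y \<in> T" using xy nb unfolding W_def by auto
      then show ?thesis by blast
    qed
    then show ?thesis using T_strong by (meson rtrancl_trans)
  qed
  define U where "U = {e \<in> uedges G. \<forall>x y. e = {x, y} \<longrightarrow> (x, y) \<notin> W}"
  let ?Q = "darcs G \<union> W"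
  have QV: "?Q \<subseteq> mverts G \<times> mverts G"
  proof (rule subrelI)
    fix x y assume "(x, y) \<in> ?Q"
    then consider "(x, y) \<in> darcs G" | "{x, y} \<in> uedges G" using W_steps by blast
    then show "(x, y) \<in> mverts G \<times> mverts G" by cases (use darcs_wf edge_ends in auto)
  qed
  have in_U: "{x, y} \<in> U \<or> (x, y) \<in> W \<or> (y, x) \<in> W" if "{x, y} \<in> uedges G" for x y
    using that unfolding U_def by (auto simp: doubleton_eq_iff)
  have "\<exists>dir. (\<forall>e \<in> U. {fst (dir e), snd (dir e)} = e) \<and>
    (\<forall>a \<in> mverts G. \<forall>b \<in> mverts G. (a, b) \<in> (?Q \<union> dir ` U)\<^sup>*)"
  proof (rule strong_orientation_exists)
    have "uedges G \<subseteq> Pow (mverts G)" using uedges_wf by blast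
    then have "finite (uedges G)" using finite_mverts finite_subset by blast
    then show "finite U" unfolding U_def by simp
    show "e \<subseteq> mverts G \<and> card e = 2" if "e \<in> U" for e using that uedges_wf unfolding U_def by blast
    show "?Q \<subseteq> mverts G \<times> mverts G" by (fact QV)
    show "(a, b) \<in> (steps ?Q U)\<^sup>*" if "a \<in> mverts G" "b \<in> mverts G" for a b
      using steps_strong[OF con that]
    proof (rule rtrancl_replace)
      fix c d assume cd: "(c, d) \<in> steps (darcs G) (uedges G)"
      show "(c, d) \<in> (steps ?Q U)\<^sup>*"
      proof (cases "(d, c) \<in> W")
        case True
        have "W\<^sup>* \<subseteq> (steps ?Q U)\<^sup>*" by (rule rtrancl_mono) (auto simp: in_steps_iff)
        then show ?thesis using W_back[OF True] by blast
      next
        case False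
        then have "(c, d) \<in> steps ?Q U" using cd in_U[of c d] by (auto simp: in_steps_iff)
        then show ?thesis by simp
      qed
    qed
    show "(x, y) \<in> (steps (?Q \<union> ?Q\<inverse>) (U - {{x, y}}))\<^sup>*" if xy: "{x, y} \<in> U" for x y
    proof -
      have "{x, y} \<in> uedges G" using xy unfolding U_def by simp
      from steps_bridgeless[OF bl this] show ?thesis
      proof (rule rtrancl_replace)
        fix c d assume "(c, d) \<in> steps (darcs G \<union> (darcs G)\<inverse>) (uedges G - {{x, y}})"
        then have "(c, d) \<in> steps (?Q \<union> ?Q\<inverse>) (U - {{x, y}})"
          using in_U[of c d] by (auto simp: in_steps_iff)
        then show "(c, d) \<in> (steps (?Q \<union> ?Q\<inverse>) (U - {{x, y}}))\<^sup>*" by simp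
      qed
    qed
  qed
  then obtain dir where "\<forall>e \<in> U. {fst (dir e), snd (dir e)} = e"
    "\<forall>a \<in> mverts G. \<forall>b \<in> mverts G. (a, b) \<in> (?Q \<union> dir ` U)\<^sup>*" by (elim exE conjE) blast
  then have dir: "\<And>e. e \<in> U \<Longrightarrow> {fst (dir e), snd (dir e)} = e"
    "\<And>a b. a \<in> mverts G \<Longrightarrow> b \<in> mverts G \<Longrightarrow> (a, b) \<in> (?Q \<union> dir ` U)\<^sup>*"
    by simp_all
  \<comment> \<open>By \<open>W_anti\<close> an edge outside \<open>U\<close> carries exactly one
    arc of \<open>W\<close>, so the choice is determined.\<close>
  define dir' where "dir' e = (if e \<in> U then dir e else SOME p. p \<in> W \<and> {fst p, snd p} = e)" for e
  have dir'_W: "dir' e \<in> W \<and> {fst (dir' e), snd (dir' e)} = e" if "e \<in> uedges G - U" for e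
  proof -
    obtain x y where "e = {x, y}" "(x, y) \<in> W" using \<open>e \<in> uedges G - U\<close> unfolding U_def by blast
    then have "\<exists>p. p \<in> W \<and> {fst p, snd p} = e" by (intro exI[of _ "(x, y)"]) simp
    from someI_ex[OF this] show ?thesis using that unfolding dir'_def by simp
  qed
  define D where "D = \<lparr>pverts = mverts G, parcs = darcs G \<union> dir' ` uedges G\<rparr>"
  have ends: "{fst (dir' e), snd (dir' e)} = e" if "e \<in> uedges G" for e
    using that dir'_W dir(1) unfolding dir'_def by (cases "e \<in> U") auto
  then have orient: "orientation G D" unfolding orientation_def D_def by blast
  have WD: "W \<subseteq> parcs D"
  proof (rule subrelI)
    fix x y assume xy: "(x, y) \<in> W"
    show "(x, y) \<in> parcs D"
    proof (cases "{x, y} \<in> uedges G")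
      case True
      then have e: "{x, y} \<in> uedges G - U" using xy unfolding U_def by blast
      have "dir' {x, y} = (x, y)"
        using dir'_W[OF e] W_anti[OF xy True] by (cases "dir' {x, y}") (auto simp: doubleton_eq_iff)
      then show ?thesis using True unfolding D_def by force
    next
      case False
      then show ?thesis using W_steps[OF xy] unfolding D_def by simp
    qed
  qed
  have DV: "parcs D \<subseteq> mverts G \<times> mverts G"
  proof (rule subrelI)
    fix x y assume "(x, y) \<in> parcs D"
    then consider "(x, y) \<in> darcs G" | e where "e \<in> uedges G" "dir' e = (x, y)"
      unfolding D_def by auto
    then show "(x, y) \<in> mverts G \<times> mverts G"
    proof cases
      case 1
      then show ?thesis using darcs_wf by simp
    next
      case 2
      then have "{x, y} \<in> uedges G" using ends[OF 2(1)] by simp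
      then show ?thesis using edge_ends by simp
    qed
  qed
  show ?thesis
  proof (rule oriented_diameter_le_if_joined[OF orient mverts_nonempty DV])
    fix x y assume xy: "x \<in> mverts G" "y \<in> mverts G"
    show "joined (parcs D) (card (mverts G) - card T + k) x y"
    proof (rule joined_if_links_joined[OF finite_mverts TV DV _ _ xy])
      have "dir ` U \<subseteq> parcs D" unfolding D_def dir'_def U_def by auto
      then have "?Q \<union> dir ` U \<subseteq> parcs D" using WD unfolding D_def by auto
      then have "(?Q \<union> dir ` U)\<^sup>* \<subseteq> (parcs D)\<^sup>*" by (rule rtrancl_mono)
      then show "(a, b) \<in> (parcs D)\<^sup>*" if "a \<in> mverts G" "b \<in> mverts G" for a b
        using dir(2)[OF that] by blast
      show "joined (links T (parcs D)) k p q" if "p \<in> T" "q \<in> T" for p q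
        using joined_mono_rel[OF links_mono[OF WD] joined_W[OF that]] .
    qed
  qed
qed
qed

lemma (in mixed_graph) oriented_diameter_le:
  assumes "bridgeless G" and u: "u \<in> mverts G"
    and X: "X \<subseteq> out_neighbours u" and Y: "Y \<subseteq> in_neighbours u"
    and "routing (links (insert u (undirected_neighbours u \<union> X \<union> Y)) (free_steps u)) u
      (undirected_neighbours u) X Y k"
    and k: "k \<le> m + card X + card Y + 1"
  shows "oriented_diameter G \<le> enat (card (mverts G) - undirected_degree G u + m)"
proof -
  let ?T = "insert u (undirected_neighbours u \<union> X \<union> Y)"
  have fin: "finite (undirected_neighbours u)" "finite X" "finite Y"
    using finite_neighbours X Y finite_subset by metis+
  have "card ?T = 1 + card (undirected_neighbours u \<union> X \<union> Y)"
    using neighbours_disjoint[of u] X Y fin by (subst card_insert_disjoint) auto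
  also have "card (undirected_neighbours u \<union> X \<union> Y) = card (undirected_neighbours u) + card X + card Y"
    using neighbours_disjoint[of u] X Y fin
    by (subst card_Un_disjoint, simp, simp, blast, subst card_Un_disjoint) auto
  finally have "card ?T = 1 + undirected_degree G u + card X + card Y"
    by (simp add: card_undirected_neighbours)
  moreover have "card ?T \<le> card (mverts G)"
    using u X Y neighbours_subset by (intro card_mono finite_mverts) blast
  ultimately have "card (mverts G) - card ?T + k \<le> card (mverts G) - undirected_degree G u + m"
    using k by linarith
  then show ?thesis
    using oriented_diameter_le_if_routing[OF assms(1) u X Y refl assms(5)] by (meson enat_ord_simps(1) order_trans)
qed

text \<open>Free steps enter \<open>u\<close> only along directed edges, so the last arc starts at
  an in-neighbour. That vertex is in \<open>T\<close>, hence it is not an inner vertex of the link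
  but its start.\<close>

lemma (in mixed_graph) link_to_centre:
  assumes "(v, u) \<in> links T (free_steps u)" "in_neighbours u \<subseteq> T"
  shows "v \<in> in_neighbours u"
proof -
  have "((v, False), (u, True)) \<in> (lift T (free_steps u))\<^sup>*"
    using assms by (simp add: in_links_iff link_def)
  then obtain p where p: "((v, False), p) \<in> (lift T (free_steps u))\<^sup>*" "(p, (u, True)) \<in> lift T (free_steps u)"
    by (rule rtranclE) auto
  obtain w where w: "p = (w, False)" "(w, u) \<in> free_steps u"
    using p(2) by (cases p) (auto simp: in_lift_iff)
  then have "(w, u) \<in> darcs G" by (simp add: in_free_steps_iff)
  then have "w \<in> in_neighbours u" unfolding in_neighbours_def by simp
  moreover from this have "w \<in> T" using assms(2) by auto
  ultimately show ?thesis using lift_source[of "(v, False)" w T "free_steps u"] p(1) w(1) by simp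
qed

lemma (in mixed_graph) link_from_centre:
  assumes "(u, v) \<in> links T (free_steps u)" "out_neighbours u \<subseteq> T"
  shows "v \<in> out_neighbours u"
proof -
  have "((u, False), (v, True)) \<in> (lift T (free_steps u))\<^sup>*"
    using assms by (simp add: in_links_iff link_def)
  then obtain p where p: "((u, False), p) \<in> lift T (free_steps u)" "(p, (v, True)) \<in> (lift T (free_steps u))\<^sup>*"
    by (rule converse_rtranclE) auto
  obtain w where w: "p = (w, w \<in> T)" "(u, w) \<in> free_steps u"
    using p(1) by (cases p) (auto simp: in_lift_iff)
  then have "(u, w) \<in> darcs G" by (simp add: in_free_steps_iff)
  then have "w \<in> out_neighbours u" unfolding out_neighbours_def by simp
  moreover from this have "p = (w, True)" using w(1) assms(2) by auto
  ultimately show ?thesis using lift_sink p(2) by fastforce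
qed

section \<open>The bounds in the individual cases\<close>

lemma (in mixed_graph) oriented_diameter_general:
  assumes "bridgeless G" "u \<in> mverts G"
  shows "oriented_diameter G \<le> enat (card (mverts G) - undirected_degree G u + 4)"
proof (rule oriented_diameter_le[OF assms, of "{}" "{}" 5])
  show "routing (links (insert u (undirected_neighbours u \<union> {} \<union> {})) (free_steps u)) u
      (undirected_neighbours u) {} {} 5"
    by (rule neighbourhood_links.routing_5[OF neighbourhood_links_free_steps[OF assms(1)]]) auto
qed auto

lemma (in mixed_graph) oriented_diameter_undirected:
  assumes "bridgeless G" "u \<in> mverts G" "darcs G = {}"
  shows "oriented_diameter G \<le> enat (card (mverts G) - undirected_degree G u + 3)"
proof (rule oriented_diameter_le[OF assms(1,2), of "{}" "{}" 4])
  let ?T = "insert u (undirected_neighbours u \<union> {} \<union> {})"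
  have "(free_steps u)\<inverse> = free_steps u"
    using assms(3) by (auto simp: in_free_steps_iff insert_commute)
  then have "sym (links ?T (free_steps u))"
    using links_converse[of ?T "free_steps u"] by (simp add: sym_conv_converse_eq)
  moreover have "(v, u) \<notin> links ?T (free_steps u)" for v
    using link_to_centre[of v u ?T] assms(3) unfolding in_neighbours_def by auto
  ultimately show "routing (links ?T (free_steps u)) u (undirected_neighbours u) {} {} 4"
    by (intro neighbourhood_links.routing_4[OF neighbourhood_links_free_steps[OF assms(1)]]) auto
qed auto

text \<open>Exactly two directed neighbours enter \<open>T\<close>, even if \<open>u\<close> has
  more. Connectivity supplies the links at a single one of them, and at the pair as a whole when
  both have the same direction; two out-neighbours are handled by reversal.\<close>

lemma (in mixed_graph) oriented_diameter_two_directed: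
  assumes bl: "bridgeless G" and u: "u \<in> mverts G"
    and two: "directed_out_degree G u + directed_in_degree G u \<ge> 2"
  shows "oriented_diameter G \<le> enat (card (mverts G) - undirected_degree G u + 3)"
proof -
  let ?N = "undirected_neighbours u"
  have con: "mixed_connected G" using bl unfolding bridgeless_def by simp
  note disj = neighbours_disjoint[of u]
  have cards: "card (out_neighbours u) + card (in_neighbours u) \<ge> 2"
    using two by (simp add: card_out_neighbours card_in_neighbours)
  have leaving: "\<exists>s \<in> S. \<exists>t \<in> T - S. (s, t) \<in> links T (free_steps u)"
    "\<exists>s \<in> S. \<exists>t \<in> T - S. (t, s) \<in> links T (free_steps u)"
    if "T = insert u (?N \<union> Z)" "S \<subseteq> Z" "S \<noteq> {}" "S \<subseteq> out_neighbours u \<union> in_neighbours u" for S Z T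
  proof -
    have *: "insert u ?N \<subseteq> T" "S \<subseteq> T - {u} - ?N" "S \<subseteq> mverts G"
      using that disj neighbours_subset[of u] by auto
    show "\<exists>s \<in> S. \<exists>t \<in> T - S. (s, t) \<in> links T (free_steps u)"
      "\<exists>s \<in> S. \<exists>t \<in> T - S. (t, s) \<in> links T (free_steps u)"
      using leaving_free_steps[OF con u * that(3)] by auto
  qed
  consider (in2) "card (in_neighbours u) \<ge> 2" | (out2) "card (out_neighbours u) \<ge> 2"
    | (both) "card (out_neighbours u) \<ge> 1" "card (in_neighbours u) \<ge> 1"
    using cards by linarith
  then show ?thesis
  proof cases
    case in2
    then obtain Y where Y: "Y \<subseteq> in_neighbours u" "card Y = 2" by (rule obtain_subset_with_card_n)
    then obtain y1 y2 where y: "Y = {y1, y2}" by (auto simp: card_2_iff)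
    let ?T = "insert u (?N \<union> {} \<union> Y)"
    let ?F = "links ?T (free_steps u)"
    interpret neighbourhood_links ?F u ?N "{}" Y
      by (rule neighbourhood_links_free_steps[OF bl]) (use Y in auto)
    have "routing ?F u ?N {} Y 6"
    proof (rule routing_two_in[OF _ y])
      show "\<exists>w. (w, y) \<in> ?F" if "y \<in> Y" for y
        using leaving(2)[of ?T Y "{y}"] that Y(1) by auto
      show "\<exists>y \<in> Y. \<exists>w. w \<notin> Y \<and> (w, y) \<in> ?F"
        using leaving(2)[of ?T Y Y] Y y by auto
    qed simp
    then show ?thesis by (rule oriented_diameter_le[OF bl u, rotated 2]) (use Y in auto)
  next
    case out2
    then obtain X where X: "X \<subseteq> out_neighbours u" "card X = 2" by (rule obtain_subset_with_card_n)
    then obtain x1 x2 where x: "X = {x1, x2}" by (auto simp: card_2_iff)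
    let ?T = "insert u (?N \<union> X \<union> {})"
    let ?F = "links ?T (free_steps u)"
    have "neighbourhood_links ?F u ?N X {}"
      by (rule neighbourhood_links_free_steps[OF bl]) (use X in auto)
    then interpret neighbourhood_links "?F\<inverse>" u ?N "{}" X by (rule neighbourhood_links_converse)
    have "routing (?F\<inverse>) u ?N {} X 6"
    proof (rule routing_two_in[OF _ x])
      show "\<exists>w. (w, y) \<in> ?F\<inverse>" if "y \<in> X" for y
        using leaving(1)[of ?T X "{y}"] that X(1) by auto
      show "\<exists>y \<in> X. \<exists>w. w \<notin> X \<and> (w, y) \<in> ?F\<inverse>"
        using leaving(1)[of ?T X X] X x by auto
    qed simp
    from routing_converse[OF this] have "routing ?F u ?N X {} 6" by simp
    then show ?thesis by (rule oriented_diameter_le[OF bl u, rotated 2]) (use X in auto)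
  next
    case both
    then obtain x y where xy: "x \<in> out_neighbours u" "y \<in> in_neighbours u"
      by (metis card.empty equals0I not_one_le_zero)
    let ?T = "insert u (?N \<union> {x} \<union> {y})"
    let ?F = "links ?T (free_steps u)"
    have T: "?T = insert u (?N \<union> {x, y})" by auto
    interpret neighbourhood_links ?F u ?N "{x}" "{y}"
      by (rule neighbourhood_links_free_steps[OF bl]) (use xy in auto)
    have "routing ?F u ?N {x} {y} 6"
    proof (rule routing_in_out[OF refl refl])
      show "\<exists>w. (x, w) \<in> ?F" using leaving(1)[OF T, of "{x}"] xy by auto
      show "\<exists>w. (w, y) \<in> ?F" using leaving(2)[OF T, of "{y}"] xy by auto
    qed
    then show ?thesis by (rule oriented_diameter_le[OF bl u, rotated 2]) (use xy in auto)
  qed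
qed

lemma (in mixed_graph) oriented_diameter_five_one:
  assumes bl: "bridgeless G" and u: "u \<in> mverts G" and five: "undirected_degree G u = 5"
    and one: "directed_out_degree G u + directed_in_degree G u = 1"
  shows "oriented_diameter G \<le> enat (card (mverts G) - undirected_degree G u + 3)"
proof -
  let ?N = "undirected_neighbours u"
  have con: "mixed_connected G" using bl unfolding bridgeless_def by simp
  note disj = neighbours_disjoint[of u]
  have N5: "card ?N = 5" using five by (simp add: card_undirected_neighbours)
  consider (out) "card (out_neighbours u) = 1" "card (in_neighbours u) = 0"
    | (inn) "card (out_neighbours u) = 0" "card (in_neighbours u) = 1"
    using one by (auto simp: card_out_neighbours card_in_neighbours add_is_1)
  then show ?thesis
  proof cases
    case out
    then obtain x where x: "out_neighbours u = {x}" by (auto simp: card_1_singleton_iff)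
    have none: "in_neighbours u = {}" using out finite_neighbours by simp
    let ?T = "insert u (?N \<union> {x} \<union> {})"
    let ?F = "links ?T (free_steps u)"
    interpret neighbourhood_links ?F u ?N "{x}" "{}"
      by (rule neighbourhood_links_free_steps[OF bl]) (use x in auto)
    have "routing ?F u ?N {x} {} 5"
    proof (rule routing_card_5[OF refl refl _ _ _ N5])
      have "insert u ?N \<subseteq> ?T" "{x} \<subseteq> ?T - {u} - ?N" "{x} \<subseteq> mverts G" "{x} \<noteq> {}"
        using disj x neighbours_subset[of u] by auto
      from leaving_free_steps(1)[OF con u this] show "\<exists>w. (x, w) \<in> ?F" by auto
      \<comment> \<open>The only directed edge at \<open>u\<close> leads to \<open>x\<close>, so no
        link enters \<open>u\<close> and every link from \<open>u\<close> ends at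
        \<open>x\<close>.\<close>
      show "(v, u) \<notin> ?F" for v using link_to_centre[of v u ?T] none by auto
      show "(u, v) \<notin> ?F" if "v \<in> ?N" for v using link_from_centre[of u v ?T] that x disj by auto
    qed
    then show ?thesis by (rule oriented_diameter_le[OF bl u, rotated 2]) (use x in auto)
  next
    case inn
    then obtain y where y: "in_neighbours u = {y}" by (auto simp: card_1_singleton_iff)
    have none: "out_neighbours u = {}" using inn finite_neighbours by simp
    let ?T = "insert u (?N \<union> {} \<union> {y})"
    let ?F = "links ?T (free_steps u)"
    have nl: "neighbourhood_links ?F u ?N {} {y}"
      by (rule neighbourhood_links_free_steps[OF bl]) (use y in auto)
    then interpret neighbourhood_links "?F\<inverse>" u ?N "{y}" "{}" by (rule neighbourhood_links_converse)
    have "routing (?F\<inverse>) u ?N {y} {} 5"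
    proof (rule routing_card_5[OF refl refl _ _ _ N5])
      have "insert u ?N \<subseteq> ?T" "{y} \<subseteq> ?T - {u} - ?N" "{y} \<subseteq> mverts G" "{y} \<noteq> {}"
        using disj y neighbours_subset[of u] by auto
      from leaving_free_steps(2)[OF con u this] show "\<exists>w. (y, w) \<in> ?F\<inverse>" by auto
      show "(v, u) \<notin> ?F\<inverse>" for v using link_from_centre[of u v ?T] none by auto
      show "(u, v) \<notin> ?F\<inverse>" if "v \<in> ?N" for v using link_to_centre[of v u ?T] that y disj by auto
    qed
    from routing_converse[OF this] have "routing ?F u ?N {} {y} 5" by simp
    then show ?thesis by (rule oriented_diameter_le[OF bl u, rotated 2]) (use y in auto)
  qed
qed

theorem corollary1p4:
  fixes G :: "'a mixed_graph" and n :: nat and \<Delta> :: nat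
  assumes "mixed_graph G" and "bridgeless G"
    and n_def: "n = card (mverts G)"
    and \<Delta>_def: "\<Delta> = max_undirected_degree G"
  shows "if darcs G = {}
            \<or> (\<exists>u \<in> mverts G. undirected_degree G u = \<Delta>
                 \<and> directed_out_degree G u + directed_in_degree G u \<ge> 2)
            \<or> (\<exists>u \<in> mverts G. undirected_degree G u = \<Delta> \<and> \<Delta> = 5
                 \<and> directed_out_degree G u + directed_in_degree G u = 1)
         then oriented_diameter G \<le> enat (n - \<Delta> + 3)
         else oriented_diameter G \<le> enat (n - \<Delta> + 4)"
proof -
  interpret mixed_graph G by fact
  have fin: "finite (undirected_degree G ` mverts G)" using finite_mverts by simp
  have "\<Delta> \<in> undirected_degree G ` mverts G"
    unfolding \<Delta>_def max_undirected_degree_def using fin mverts_nonempty by (intro Max_in) auto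
  then obtain v where v: "v \<in> mverts G" "undirected_degree G v = \<Delta>" by blast
  consider (undirected) "darcs G = {}"
    | (two) u where "u \<in> mverts G" "undirected_degree G u = \<Delta>"
        "directed_out_degree G u + directed_in_degree G u \<ge> 2"
    | (five) u where "u \<in> mverts G" "undirected_degree G u = \<Delta>" "\<Delta> = 5"
        "directed_out_degree G u + directed_in_degree G u = 1"
    | (other) "\<not> (darcs G = {}
            \<or> (\<exists>u \<in> mverts G. undirected_degree G u = \<Delta>
                 \<and> directed_out_degree G u + directed_in_degree G u \<ge> 2)
            \<or> (\<exists>u \<in> mverts G. undirected_degree G u = \<Delta> \<and> \<Delta> = 5
                 \<and> directed_out_degree G u + directed_in_degree G u = 1))"
    by blast
  then show ?thesis
  proof cases
    case undirected
    then show ?thesis using oriented_diameter_undirected[OF assms(2) v(1)] v(2) n_def by simp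
  next
    case two
    then show ?thesis using oriented_diameter_two_directed[OF assms(2), of u] n_def by auto
  next
    case five
    then show ?thesis using oriented_diameter_five_one[OF assms(2), of u] n_def by auto
  next
    case other
    then show ?thesis using oriented_diameter_general[OF assms(2) v(1)] v(2) n_def by (simp only: if_False)
  qed
qed

end
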